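(* Let $n\geq 0$. Every $n$-dimensional opetopic sequence $$N_0\to\ldots\to N_n$$ is isomorphic to the sequence $$G_0^-(\langle K\rangle)\to\ldots\to G_n^-(\langle K\rangle)$$ for some $n$-dimensional opetopic directed complex $K$, and $K$ is uniquely determined up to isomorphism. The complex $K$ is reduced if and only if the sequence $N_0\to\ldots\to N_n$ is an $n$-dimensional opetope.
   Context: **Complexes.** A *free augmented directed complex* $K$ is an augmented chain complex of free abelian groups $K_q$, $q\geq 0$ (boundary $\partial\colon K_{q+1}\to K_q$ with $\partial\partial=0$, $\partial=0$ on $K_0$, augmentation $\epsilon\colon K_0\to\mathbb{Z}$ with $\epsilon\partial=0$), together with a distinguished basis for each $K_q$. Members of the basis of $K_q$ are the $q$-dimensional basis elements. A "sum of basis elements" is a (possibly empty, possibly with repetitions) finite sum of basis elements; its terms are the basis elements occurring in it. For a chain $c$ write $\partial c=\partial^+c-\partial^-c$ where $\partial^+c,\partial^-c$ are sums of basis elements with no common terms; $(\partial^\pm)^r$ denotes the $r$-fold iterate of $\partial^\pm$. $K$ is *unital* if $\epsilon(\partial^-)^q a=\epsilon(\partial^+)^q a=1$ for each basis element $a$ of dimension $q$. $K$ is *loop-free* if its basis elements can be partially ordered so that, for any basis element $a$ and any integer $r>0$, the basis elements which are terms in $(\partial^-)^r a$ (strictly) precede those which are terms in $(\partial^+)^r a$. $K$ is *atomic of dimension $n$* (or $n$-dimensional atomic) if it has no basis elements of dimension greater than $n$, exactly one basis element of dimension $n$, and every basis element of dimension less than $n$ is a term in $\partial^-a$ or $\partial^+a$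 for some higher-dimensional basis element $a$. An *opetopic directed complex* is an atomic loop-free unital free augmented directed complex with a distinguished class of positive-dimensional basis elements called *thin*, such that: (1) if $a$ is a positive-dimensional basis element then $\partial^+a$ is a non-thin basis element; (2) if $a$ is a thin basis element then $\partial^-a$ is a non-thin basis element. It is *reduced* if every thin basis element is of the form $\partial^-a$ for some other basis element $a$. Isomorphisms of opetopic directed complexes are isomorphisms of augmented chain complexes restricting to bijections between the distinguished bases and between the thin basis elements. **Networks.** A *network* consists of finite sets $E$ (edges) and $V$ (vertices), subsets $I\subseteq E$ (input edges) and $O\subseteq E$ (output edges), and functions $s\colon E\setminus I\to V$, $t\colon E\setminus O\to V$ (source and target). A *path* from an edge $e'$ to an edge $e$ is a sequence $e_0,v_1,e_1,\dots,v_k,e_k$ ($k\ge 0$) of edges $e_r$ and vertices $v_r$ with $v_r=t(e_{r-1})=s(e_r)$, $e_0=e'$, $e_k=e$. A network is *acyclic* if there is no path from any edge $e$ to itself other than the single-term path $e$; it is *linear* if it is acyclic and consists of a single path (all its edges and vertices are those of one path). An *opetopic network* is an acyclic network with a unique output edge, with distinguished sets of *thin* edges and *thin* vertices, such that every thin edge is an input edge, and every thin vertex is the target for a unique edge, which is not thin. It is *reduced* if every thin edge has a target vertex, and this vertex is not the target for any other edge. A *constellation* from an opetopic network $N$ to an opetopic network $P$ is a bijection $c$ from the set of vertices of $N$ to the set of input edges of $P$ such that thin vertices of $N$ correspond to thin edges of $P$ and such that: if $e$ is an edge of $P$ and $I_e$ is the set of input edges $e'$ of $P$ such that there is a path in $P$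 from $e'$ to $e$, then there is exactly one edge in $N$ with a source but not a target in $c^{-1}(I_e)$. An $n$-dimensional *opetopic sequence* is a sequence of opetopic networks and constellations $N_0\to N_1\to\ldots\to N_n$ such that $N_0$ is linear with no thin edges and $N_n$ consists of a single edge. An $n$-dimensional *opetope* is an $n$-dimensional opetopic sequence in which all the networks $N_q$ are reduced. Isomorphisms of such sequences are families of network isomorphisms preserving thin edges and vertices and compatible with the constellations. **The sequence associated to $K$.** If $K$ is an $n$-dimensional opetopic directed complex with $n$-dimensional basis element $g$, let $x_q^\alpha=(\partial^\alpha)^{n-q}g$ for $0\leq q\leq n$ and $x_q^\alpha=0$ for $q>n$ ($\alpha=\pm$), and let $\langle K\rangle=(x_0^-,x_0^+\mid x_1^-,x_1^+\mid\ldots)$. Writing $x_{q+1}^-=a_1+\ldots+a_k$ as a sum of basis elements, put $g_q^-(\langle K\rangle)=x_q^-+\partial^+a_1+\ldots+\partial^+a_k$. The network $G_q^-(\langle K\rangle)$ has as edges the basis elements which are terms in $g_q^-(\langle K\rangle)$ and as vertices the $(q+1)$-dimensional basis elements which are terms in $x_{q+1}^-$; the edges with target the vertex $a$ are the terms of $\partial^-a$, and the edges with source the vertex $a$ are the terms of $\partial^+a$; edges without a source are input edges and edges without a target are output edges. Thin edges and vertices are those given by thin basis elements. The input edges of $G_{q+1}^-(\langle K\rangle)$ are the terms of $x_{q+1}^-$, and the map $G_q^-(\langle K\rangle)\to G_{q+1}^-(\langle K\rangle)$ is the bijection from vertices to input edges sending the vertex given by a basis element $a$ to the input edge given by $a$;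 with these data $G_0^-(\langle K\rangle)\to\ldots\to G_n^-(\langle K\rangle)$ is an $n$-dimensional opetopic sequence. *)

theory Defs
  imports "HOL-Algebra.Free_Abelian_Groups" "HOL-Library.Disjoint_Sets"
begin

text \<open>
  The group of \<open>q\<close>-chains is the free abelian group on the distinguished basis \<open>basis K q\<close>.
  A chain is a finitely supported function \<open>'b \<Rightarrow>\<^sub>0 int\<close>; the basis element \<open>a\<close>, regarded as a
  chain, is \<open>frag_of a\<close>, and the terms of a chain are its \<open>keys\<close>.  Bases of different
  dimensions are disjoint, so that one function \<open>bdry\<close> can hold the boundaries of all degrees.
  Values of \<open>bdry\<close> and \<open>aug\<close> outside the relevant chain groups carry no meaning.
\<close>

record 'b complex_data =
  basis :: "nat \<Rightarrow> 'b set"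
  bdry :: "('b \<Rightarrow>\<^sub>0 int) \<Rightarrow> ('b \<Rightarrow>\<^sub>0 int)"
  aug :: "('b \<Rightarrow>\<^sub>0 int) \<Rightarrow> int"

definition chain_group :: "('b, 'm) complex_data_scheme \<Rightarrow> nat \<Rightarrow> ('b \<Rightarrow>\<^sub>0 int) monoid" where
  "chain_group K q = free_Abelian_group (basis K q)"

definition basis_elements :: "('b, 'm) complex_data_scheme \<Rightarrow> 'b set" where
  "basis_elements K = (\<Union>q. basis K q)"

definition free_augmented_directed_complex :: "('b, 'm) complex_data_scheme \<Rightarrow> bool" where
  "free_augmented_directed_complex K \<longleftrightarrow>
     disjoint_family (basis K) \<and>
     (\<forall>q. bdry K \<in> hom (chain_group K (Suc q)) (chain_group K q)) \<and>
     (\<forall>q. \<forall>c \<in> carrier (chain_group K (Suc (Suc q))). bdry K (bdry K c) = 0) \<and>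
     (\<forall>c \<in> carrier (chain_group K 0). bdry K c = 0) \<and>
     aug K \<in> hom (chain_group K 0) integer_group \<and>
     (\<forall>c \<in> carrier (chain_group K (Suc 0)). aug K (bdry K c) = 0)"

definition bdry_plus :: "('b, 'm) complex_data_scheme \<Rightarrow> ('b \<Rightarrow>\<^sub>0 int) \<Rightarrow> ('b \<Rightarrow>\<^sub>0 int)" where
  "bdry_plus K c = Poly_Mapping.map (\<lambda>m. max m 0) (bdry K c)"

definition bdry_minus :: "('b, 'm) complex_data_scheme \<Rightarrow> ('b \<Rightarrow>\<^sub>0 int) \<Rightarrow> ('b \<Rightarrow>\<^sub>0 int)" where
  "bdry_minus K c = Poly_Mapping.map (\<lambda>m. max (- m) 0) (bdry K c)"

text \<open>
  These are the only chains with non-negative coefficients (sums of basis elements) and no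
  common terms whose difference is the boundary.
\<close>

lemma lookup_bdry_plus:
  "Poly_Mapping.lookup (bdry_plus K c) i = max (Poly_Mapping.lookup (bdry K c) i) 0"
  by (simp add: bdry_plus_def Poly_Mapping.map.rep_eq when_def)

lemma lookup_bdry_minus:
  "Poly_Mapping.lookup (bdry_minus K c) i = max (- Poly_Mapping.lookup (bdry K c) i) 0"
  by (simp add: bdry_minus_def Poly_Mapping.map.rep_eq when_def)

lemma bdry_plus_minus_iff:
  "(p = bdry_plus K c \<and> m = bdry_minus K c) \<longleftrightarrow>
     bdry K c = p - m \<and>
     (\<forall>i. 0 \<le> Poly_Mapping.lookup p i) \<and> (\<forall>i. 0 \<le> Poly_Mapping.lookup m i) \<and>
     Poly_Mapping.keys p \<inter> Poly_Mapping.keys m = {}"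
proof -
  let ?b = "Poly_Mapping.lookup (bdry K c)"
  let ?p = "Poly_Mapping.lookup p" and ?m = "Poly_Mapping.lookup m"
  have "(p = bdry_plus K c \<and> m = bdry_minus K c) \<longleftrightarrow>
      (\<forall>i. ?p i = max (?b i) 0 \<and> ?m i = max (- ?b i) 0)"
    by (auto simp: poly_mapping_eq_iff fun_eq_iff lookup_bdry_plus lookup_bdry_minus)
  also have "\<dots> \<longleftrightarrow>
      (\<forall>i. ?b i = ?p i - ?m i \<and> 0 \<le> ?p i \<and> 0 \<le> ?m i \<and> (?p i = 0 \<or> ?m i = 0))"
    by (intro all_cong1) (auto simp: max_def)
  also have "\<dots> \<longleftrightarrow> bdry K c = p - m \<and> (\<forall>i. 0 \<le> ?p i) \<and> (\<forall>i. 0 \<le> ?m i) \<and>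
      Poly_Mapping.keys p \<inter> Poly_Mapping.keys m = {}"
    by (auto simp: poly_mapping_eq_iff fun_eq_iff lookup_minus disjoint_iff Poly_Mapping.in_keys_iff)
  finally show ?thesis .
qed

definition unital :: "('b, 'm) complex_data_scheme \<Rightarrow> bool" where
  "unital K \<longleftrightarrow>
     (\<forall>q. \<forall>a \<in> basis K q.
        aug K ((bdry_minus K ^^ q) (frag_of a)) = 1 \<and> aug K ((bdry_plus K ^^ q) (frag_of a)) = 1)"

definition loop_free :: "('b, 'm) complex_data_scheme \<Rightarrow> bool" where
  "loop_free K \<longleftrightarrow>
     (\<exists>R. partial_order_on (basis_elements K) R \<and>
        (\<forall>a \<in> basis_elements K. \<forall>r > 0.
           \<forall>x \<in> Poly_Mapping.keys ((bdry_minus K ^^ r) (frag_of a)).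
           \<forall>y \<in> Poly_Mapping.keys ((bdry_plus K ^^ r) (frag_of a)). (x, y) \<in> R \<and> x \<noteq> y))"

definition atomic :: "nat \<Rightarrow> ('b, 'm) complex_data_scheme \<Rightarrow> bool" where
  "atomic n K \<longleftrightarrow>
     (\<forall>q > n. basis K q = {}) \<and>
     (\<exists>!g. g \<in> basis K n) \<and>
     (\<forall>q < n. \<forall>b \<in> basis K q. \<exists>p > q. \<exists>a \<in> basis K p.
        b \<in> Poly_Mapping.keys (bdry_minus K (frag_of a)) \<or>
        b \<in> Poly_Mapping.keys (bdry_plus K (frag_of a)))"

record 'b thin_complex = "'b complex_data" +
  thin :: "'b set"

definition opetopic_directed_complex :: "nat \<Rightarrow> 'b thin_complex \<Rightarrow> bool" where
  "opetopic_directed_complex n K \<longleftrightarrow>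
     free_augmented_directed_complex K \<and> atomic n K \<and> loop_free K \<and> unital K \<and>
     thin K \<subseteq> (\<Union>q \<in> {0<..}. basis K q) \<and>
     (\<forall>q > 0. \<forall>a \<in> basis K q.
        \<exists>b \<in> basis_elements K. b \<notin> thin K \<and> bdry_plus K (frag_of a) = frag_of b) \<and>
     (\<forall>a \<in> thin K.
        \<exists>b \<in> basis_elements K. b \<notin> thin K \<and> bdry_minus K (frag_of a) = frag_of b)"

definition reduced_complex :: "'b thin_complex \<Rightarrow> bool" where
  "reduced_complex K \<longleftrightarrow>
     (\<forall>b \<in> thin K. \<exists>a \<in> basis_elements K. a \<noteq> b \<and> bdry_minus K (frag_of a) = frag_of b)"

definition isomorphic_complexes :: "'b thin_complex \<Rightarrow> 'c thin_complex \<Rightarrow> bool" where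
  "isomorphic_complexes K L \<longleftrightarrow>
     (\<exists>f :: nat \<Rightarrow> ('b \<Rightarrow>\<^sub>0 int) \<Rightarrow> ('c \<Rightarrow>\<^sub>0 int).
        (\<forall>q. f q \<in> iso (chain_group K q) (chain_group L q)) \<and>
        (\<forall>q. \<forall>c \<in> carrier (chain_group K (Suc q)). f q (bdry K c) = bdry L (f (Suc q) c)) \<and>
        (\<forall>c \<in> carrier (chain_group K 0). aug L (f 0 c) = aug K c) \<and>
        (\<forall>q. bij_betw (f q) (frag_of ` basis K q) (frag_of ` basis L q)) \<and>
        (\<forall>q. bij_betw (f q) (frag_of ` (basis K q \<inter> thin K)) (frag_of ` (basis L q \<inter> thin L))))"

text \<open>
  The functions \<open>src\<close> and \<open>tgt\<close> are meaningful only on edges that are not input edges and on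
  edges that are not output edges, respectively.
\<close>

record ('e, 'v) network_data =
  edges :: "'e set"
  vertices :: "'v set"
  inputs :: "'e set"
  outputs :: "'e set"
  src :: "'e \<Rightarrow> 'v"
  tgt :: "'e \<Rightarrow> 'v"

definition network :: "('e, 'v, 'm) network_data_scheme \<Rightarrow> bool" where
  "network N \<longleftrightarrow>
     finite (edges N) \<and> finite (vertices N) \<and> inputs N \<subseteq> edges N \<and> outputs N \<subseteq> edges N \<and>
     src N \<in> edges N - inputs N \<rightarrow> vertices N \<and> tgt N \<in> edges N - outputs N \<rightarrow> vertices N"

text \<open>
  The path \<open>e\<^sub>0, v\<^sub>1, e\<^sub>1, \<dots>, v\<^sub>k, e\<^sub>k\<close> is given by the list \<open>es = [e\<^sub>0, \<dots>, e\<^sub>k]\<close> of its edges and the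
  list \<open>vs = [v\<^sub>1, \<dots>, v\<^sub>k]\<close> of its vertices.
\<close>

definition network_path ::
    "('e, 'v, 'm) network_data_scheme \<Rightarrow> 'e \<Rightarrow> 'e list \<Rightarrow> 'v list \<Rightarrow> 'e \<Rightarrow> bool" where
  "network_path N e' es vs e \<longleftrightarrow>
     length es = Suc (length vs) \<and> set es \<subseteq> edges N \<and> set vs \<subseteq> vertices N \<and>
     hd es = e' \<and> last es = e \<and>
     (\<forall>r < length vs.
        es ! r \<notin> outputs N \<and> tgt N (es ! r) = vs ! r \<and>
        es ! Suc r \<notin> inputs N \<and> src N (es ! Suc r) = vs ! r)"

definition acyclic_network :: "('e, 'v, 'm) network_data_scheme \<Rightarrow> bool" where
  "acyclic_network N \<longleftrightarrow>
     network N \<and> (\<forall>e es vs. network_path N e es vs e \<longrightarrow> es = [e] \<and> vs = [])"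

definition linear_network :: "('e, 'v, 'm) network_data_scheme \<Rightarrow> bool" where
  "linear_network N \<longleftrightarrow>
     acyclic_network N \<and>
     (\<exists>e' es vs e. network_path N e' es vs e \<and> edges N = set es \<and> vertices N = set vs)"

record ('e, 'v) thin_network = "('e, 'v) network_data" +
  thin_edges :: "'e set"
  thin_vertices :: "'v set"

definition opetopic_network :: "('e, 'v) thin_network \<Rightarrow> bool" where
  "opetopic_network N \<longleftrightarrow>
     acyclic_network N \<and>
     (\<exists>!e. e \<in> outputs N) \<and>
     thin_edges N \<subseteq> inputs N \<and>
     thin_vertices N \<subseteq> vertices N \<and>
     (\<forall>v \<in> thin_vertices N.
        (\<exists>!e. e \<in> edges N - outputs N \<and> tgt N e = v) \<and>
        (\<forall>e \<in> edges N - outputs N. tgt N e = v \<longrightarrow> e \<notin> thin_edges N))"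

definition reduced_network :: "('e, 'v) thin_network \<Rightarrow> bool" where
  "reduced_network N \<longleftrightarrow>
     (\<forall>e \<in> thin_edges N.
        e \<notin> outputs N \<and> (\<forall>d \<in> edges N - outputs N. tgt N d = tgt N e \<longrightarrow> d = e))"

definition inputs_below :: "('e, 'v) thin_network \<Rightarrow> 'e \<Rightarrow> 'e set" where
  "inputs_below P e = {e' \<in> inputs P. \<exists>es vs. network_path P e' es vs e}"

definition constellation ::
    "('v \<Rightarrow> 'f) \<Rightarrow> ('e, 'v) thin_network \<Rightarrow> ('f, 'w) thin_network \<Rightarrow> bool" where
  "constellation c N P \<longleftrightarrow>
     bij_betw c (vertices N) (inputs P) \<and>
     (\<forall>v \<in> vertices N. v \<in> thin_vertices N \<longleftrightarrow> c v \<in> thin_edges P) \<and>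
     (\<forall>e \<in> edges P.
        let S = {v \<in> vertices N. c v \<in> inputs_below P e}
        in \<exists>!d. d \<in> edges N \<and> (d \<notin> inputs N \<and> src N d \<in> S) \<and> \<not> (d \<notin> outputs N \<and> tgt N d \<in> S))"

text \<open>
  A sequence \<open>N\<^sub>0 \<rightarrow> \<dots> \<rightarrow> N\<^sub>n\<close> is given by the networks \<open>N q\<close> for \<open>q \<le> n\<close> and the maps
  \<open>c q\<close> from vertices of \<open>N q\<close> to edges of \<open>N (Suc q)\<close> for \<open>q < n\<close>; other values are ignored.
\<close>

definition opetopic_sequence ::
    "nat \<Rightarrow> (nat \<Rightarrow> ('e, 'v) thin_network) \<Rightarrow> (nat \<Rightarrow> 'v \<Rightarrow> 'e) \<Rightarrow> bool" where
  "opetopic_sequence n N c \<longleftrightarrow>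
     (\<forall>q \<le> n. opetopic_network (N q)) \<and>
     (\<forall>q < n. constellation (c q) (N q) (N (Suc q))) \<and>
     linear_network (N 0) \<and> thin_edges (N 0) = {} \<and>
     (\<exists>e. edges (N n) = {e}) \<and> vertices (N n) = {}"

definition opetope ::
    "nat \<Rightarrow> (nat \<Rightarrow> ('e, 'v) thin_network) \<Rightarrow> (nat \<Rightarrow> 'v \<Rightarrow> 'e) \<Rightarrow> bool" where
  "opetope n N c \<longleftrightarrow> opetopic_sequence n N c \<and> (\<forall>q \<le> n. reduced_network (N q))"

definition network_isomorphism ::
    "('e \<Rightarrow> 'f) \<Rightarrow> ('v \<Rightarrow> 'w) \<Rightarrow> ('e, 'v) thin_network \<Rightarrow> ('f, 'w) thin_network \<Rightarrow> bool" where
  "network_isomorphism \<phi> \<psi> N P \<longleftrightarrow>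
     bij_betw \<phi> (edges N) (edges P) \<and> bij_betw \<psi> (vertices N) (vertices P) \<and>
     (\<forall>e \<in> edges N. e \<in> inputs N \<longleftrightarrow> \<phi> e \<in> inputs P) \<and>
     (\<forall>e \<in> edges N. e \<in> outputs N \<longleftrightarrow> \<phi> e \<in> outputs P) \<and>
     (\<forall>e \<in> edges N - inputs N. src P (\<phi> e) = \<psi> (src N e)) \<and>
     (\<forall>e \<in> edges N - outputs N. tgt P (\<phi> e) = \<psi> (tgt N e)) \<and>
     (\<forall>e \<in> edges N. e \<in> thin_edges N \<longleftrightarrow> \<phi> e \<in> thin_edges P) \<and>
     (\<forall>v \<in> vertices N. v \<in> thin_vertices N \<longleftrightarrow> \<psi> v \<in> thin_vertices P)"

definition isomorphic_sequences ::
    "nat \<Rightarrow> (nat \<Rightarrow> ('e, 'v) thin_network) \<Rightarrow> (nat \<Rightarrow> 'v \<Rightarrow> 'e) \<Rightarrow>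
     (nat \<Rightarrow> ('f, 'w) thin_network) \<Rightarrow> (nat \<Rightarrow> 'w \<Rightarrow> 'f) \<Rightarrow> bool" where
  "isomorphic_sequences n N c P d \<longleftrightarrow>
     (\<exists>\<phi> \<psi>.
        (\<forall>q \<le> n. network_isomorphism (\<phi> q) (\<psi> q) (N q) (P q)) \<and>
        (\<forall>q < n. \<forall>v \<in> vertices (N q). \<phi> (Suc q) (c q v) = d q (\<psi> q v)))"

definition top_element :: "nat \<Rightarrow> ('b, 'm) complex_data_scheme \<Rightarrow> 'b" where
  "top_element n K = (THE g. g \<in> basis K n)"

definition x_minus :: "nat \<Rightarrow> ('b, 'm) complex_data_scheme \<Rightarrow> nat \<Rightarrow> ('b \<Rightarrow>\<^sub>0 int)" where
  "x_minus n K q = (if q \<le> n then (bdry_minus K ^^ (n - q)) (frag_of (top_element n K)) else 0)"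

text \<open>
  If \<open>x_minus n K (Suc q)\<close> is \<open>a\<^sub>1 + \<dots> + a\<^sub>k\<close>, then the \<open>frag_extend\<close> expression below is the
  sum of the \<open>bdry_plus K (frag_of a\<^sub>i)\<close>, repetitions included.
\<close>

definition g_minus :: "nat \<Rightarrow> ('b, 'm) complex_data_scheme \<Rightarrow> nat \<Rightarrow> ('b \<Rightarrow>\<^sub>0 int)" where
  "g_minus n K q =
     x_minus n K q + frag_extend (\<lambda>a. bdry_plus K (frag_of a)) (x_minus n K (Suc q))"

definition G_minus :: "nat \<Rightarrow> 'b thin_complex \<Rightarrow> nat \<Rightarrow> ('b, 'b) thin_network" where
  "G_minus n K q =
     (let E = Poly_Mapping.keys (g_minus n K q); V = Poly_Mapping.keys (x_minus n K (Suc q));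
          from_vertex = (\<lambda>e a. a \<in> V \<and> e \<in> Poly_Mapping.keys (bdry_plus K (frag_of a)));
          to_vertex = (\<lambda>e a. a \<in> V \<and> e \<in> Poly_Mapping.keys (bdry_minus K (frag_of a)))
      in \<lparr> edges = E, vertices = V,
           inputs = {e \<in> E. \<nexists>a. from_vertex e a},
           outputs = {e \<in> E. \<nexists>a. to_vertex e a},
           src = (\<lambda>e. THE a. from_vertex e a),
           tgt = (\<lambda>e. THE a. to_vertex e a),
           thin_edges = E \<inter> thin K,
           thin_vertices = V \<inter> thin K \<rparr>)"

text \<open>
  A vertex and the corresponding input edge of the next network are the same basis element, so
  the maps of the sequence are identities.
\<close>

definition G_map :: "nat \<Rightarrow> 'b \<Rightarrow> 'b" where
  "G_map q a = a"

end

theory Submission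
  imports Defs
begin

text \<open>
  A complex is recovered from its networks as follows.  The \<open>q\<close>-dimensional basis elements are
  the edges of \<open>N\<^sub>q\<close>.  An edge \<open>e\<close> of \<open>N\<^bsub>q+1\<^esub>\<close> corresponds, through the input edges from which there is
  a path to \<open>e\<close>, to a set \<open>S\<close> of vertices of \<open>N\<^sub>q\<close>, and the coefficient of an edge \<open>d\<close> in \<open>\<partial>e\<close> is \<open>1\<close>
  or \<open>0\<close> according to whether the source of \<open>d\<close> is in \<open>S\<close>, minus the same for its target; so the
  constellation condition says that \<open>\<partial>\<^sup>+e\<close> is a single basis element.  Since the networks are trees, \<open>S\<close> is
  additive over the edges entering a vertex, and this gives \<open>\<partial>\<partial> = 0\<close>.

  Conversely, in an opetopic directed complex \<open>\<partial>\<partial> = 0\<close> gives \<open>(\<partial>\<^sup>-)\<^sup>2 a = \<partial>\<^sup>-\<partial>\<^sup>+a\<close>, so only one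
  application of \<open>\<partial>\<^sup>-\<close> ever matters.  By induction on the dimension, a sum of basis elements with the
  same boundary as a basis element has no repeated terms: expand the top edge one vertex at a time,
  always at a maximal edge; every intermediate chain again has the boundary of a basis element.
  Hence \<open>g\<^sub>q\<^sup>-\<close> has no repeated terms and every \<open>q\<close>-dimensional basis element is one of its terms.
  The boundary of a term of \<open>x\<^sub>q\<^sup>-\<close> is read off from the network, and every other basis element has
  the form \<open>\<partial>\<^sup>+v\<close> with \<open>\<partial>\<partial>\<^sup>+v = \<partial>\<partial>\<^sup>-v\<close>, so the networks determine the complex.
\<close>

section \<open>Chains\<close>

lemma lookup_frag_extend:
  "Poly_Mapping.lookup (frag_extend f c) i =
     (\<Sum>a\<in>Poly_Mapping.keys c. Poly_Mapping.lookup c a * Poly_Mapping.lookup (f a) i)"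
  by (simp add: frag_extend_def lookup_sum)

text \<open>These are the sums of basis elements: repeated terms are allowed, cancellation is not,
  so supports behave additively.\<close>

definition nonneg_chain :: "('b \<Rightarrow>\<^sub>0 int) \<Rightarrow> bool" where
  "nonneg_chain c \<longleftrightarrow> (\<forall>i. 0 \<le> Poly_Mapping.lookup c i)"

lemma nonneg_chain_0 [simp]: "nonneg_chain 0"
  by (simp add: nonneg_chain_def)

lemma nonneg_chain_frag_of [simp]: "nonneg_chain (frag_of a)"
  by (simp add: nonneg_chain_def)

lemma nonneg_chain_add: "nonneg_chain c \<Longrightarrow> nonneg_chain d \<Longrightarrow> nonneg_chain (c + d)"
  by (simp add: nonneg_chain_def lookup_add)

lemma in_keys_nonneg_iff:
  "nonneg_chain c \<Longrightarrow> a \<in> Poly_Mapping.keys c \<longleftrightarrow> 1 \<le> Poly_Mapping.lookup c a"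
  by (auto simp: nonneg_chain_def in_keys_iff dest: spec[of _ a])

lemma nonneg_chain_diff_frag_of:
  "nonneg_chain c \<Longrightarrow> a \<in> Poly_Mapping.keys c \<Longrightarrow> nonneg_chain (c - frag_of a)"
  using in_keys_nonneg_iff[of c a] by (simp add: nonneg_chain_def lookup_minus)

lemma keys_add_nonneg:
  assumes "nonneg_chain c" "nonneg_chain d"
  shows "Poly_Mapping.keys (c + d) = Poly_Mapping.keys c \<union> Poly_Mapping.keys d"
proof -
  have "Poly_Mapping.lookup c i + Poly_Mapping.lookup d i = 0 \<longleftrightarrow>
      Poly_Mapping.lookup c i = 0 \<and> Poly_Mapping.lookup d i = 0" for i
    using assms by (simp add: nonneg_chain_def add_nonneg_eq_0_iff)
  then show ?thesis
    by (auto simp only: set_eq_iff Un_iff in_keys_iff lookup_add)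
qed

lemma nonneg_chain_frag_extend:
  assumes "nonneg_chain c" "\<And>a. a \<in> Poly_Mapping.keys c \<Longrightarrow> nonneg_chain (f a)"
  shows "nonneg_chain (frag_extend f c)"
  using assms by (auto simp: nonneg_chain_def lookup_frag_extend intro!: sum_nonneg)

lemma sum_le_lookup_frag_extend:
  assumes "nonneg_chain c" "\<And>a. a \<in> Poly_Mapping.keys c \<Longrightarrow> nonneg_chain (f a)"
    and "A \<subseteq> Poly_Mapping.keys c"
  shows "(\<Sum>a\<in>A. Poly_Mapping.lookup c a * Poly_Mapping.lookup (f a) i)
    \<le> Poly_Mapping.lookup (frag_extend f c) i"
  unfolding lookup_frag_extend
  using assms by (intro sum_mono2) (auto simp: nonneg_chain_def)

lemma lookup_le_lookup_frag_extend:
  assumes "nonneg_chain c" "\<And>a. a \<in> Poly_Mapping.keys c \<Longrightarrow> nonneg_chain (f a)"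
    and "a \<in> Poly_Mapping.keys c"
  shows "Poly_Mapping.lookup c a * Poly_Mapping.lookup (f a) i
    \<le> Poly_Mapping.lookup (frag_extend f c) i"
  using sum_le_lookup_frag_extend[of c f "{a}"] assms by simp

lemma keys_frag_extend_nonneg:
  assumes "nonneg_chain c" "\<And>a. a \<in> Poly_Mapping.keys c \<Longrightarrow> nonneg_chain (f a)"
  shows "Poly_Mapping.keys (frag_extend f c) = (\<Union>a\<in>Poly_Mapping.keys c. Poly_Mapping.keys (f a))"
proof (rule antisym[OF keys_frag_extend], rule UN_least)
  fix a assume a: "a \<in> Poly_Mapping.keys c"
  show "Poly_Mapping.keys (f a) \<subseteq> Poly_Mapping.keys (frag_extend f c)"
  proof
    fix i assume "i \<in> Poly_Mapping.keys (f a)"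
    with a assms have "1 * 1 \<le> Poly_Mapping.lookup c a * Poly_Mapping.lookup (f a) i"
      by (intro mult_mono) (auto simp: in_keys_nonneg_iff)
    also have "\<dots> \<le> Poly_Mapping.lookup (frag_extend f c) i"
      using lookup_le_lookup_frag_extend[of c f] assms a by blast
    finally show "i \<in> Poly_Mapping.keys (frag_extend f c)"
      by (auto simp: in_keys_iff)
  qed
qed

text \<open>Two distinct terms of \<open>c\<close> would each contribute at least 1 to the
  coefficient of \<open>i\<close>. This turns a coefficient bound into injectivity of outputs and
  disjointness of inputs.\<close>

lemma disjoint_keys_if_lookup_frag_extend_le_1:
  assumes c: "nonneg_chain c" and f: "\<And>a. a \<in> Poly_Mapping.keys c \<Longrightarrow> nonneg_chain (f a)"
    and le: "Poly_Mapping.lookup (frag_extend f c) i \<le> 1"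
    and ab: "a \<in> Poly_Mapping.keys c" "b \<in> Poly_Mapping.keys c"
      "i \<in> Poly_Mapping.keys (f a)" "i \<in> Poly_Mapping.keys (f b)"
  shows "a = b"
proof (rule ccontr)
  assume "a \<noteq> b"
  have "1 * 1 \<le> Poly_Mapping.lookup c a * Poly_Mapping.lookup (f a) i"
    "1 * 1 \<le> Poly_Mapping.lookup c b * Poly_Mapping.lookup (f b) i"
    using ab c f by (intro mult_mono; auto simp: in_keys_nonneg_iff)+
  moreover have "Poly_Mapping.lookup c a * Poly_Mapping.lookup (f a) i +
      Poly_Mapping.lookup c b * Poly_Mapping.lookup (f b) i \<le> Poly_Mapping.lookup (frag_extend f c) i"
    using sum_le_lookup_frag_extend[OF c, of f "{a, b}" i] f ab \<open>a \<noteq> b\<close> by auto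
  ultimately show False
    using le by linarith
qed

text \<open>All coefficients are 0 or 1, so the support determines the chain. Networks record only
  supports, and this recovers the chains from them.\<close>

lemma chain_eq_sum_keys:
  assumes "nonneg_chain c" "\<And>i. Poly_Mapping.lookup c i \<le> 1"
  shows "c = (\<Sum>a\<in>Poly_Mapping.keys c. frag_of a)"
proof (rule poly_mapping_eqI)
  fix i
  have "Poly_Mapping.lookup c i \<in> {0, 1}"
    using assms by (auto simp: nonneg_chain_def dest!: spec[of _ i] meta_spec[of _ i])
  then show "Poly_Mapping.lookup c i = Poly_Mapping.lookup (\<Sum>a\<in>Poly_Mapping.keys c. frag_of a) i"
    by (auto simp: lookup_sum sum.delta in_keys_iff)
qed

text \<open>On 0-chains of a unital complex this is the augmentation (\<open>aug_eq\<close>). On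
  sums of basis elements it counts the terms with repetitions and serves as an induction
  measure.\<close>

definition coeff_sum :: "('b \<Rightarrow>\<^sub>0 int) \<Rightarrow> int" where
  "coeff_sum c = (\<Sum>a\<in>Poly_Mapping.keys c. Poly_Mapping.lookup c a)"

lemma coeff_sum_eq_sum:
  "finite A \<Longrightarrow> Poly_Mapping.keys c \<subseteq> A \<Longrightarrow> coeff_sum c = (\<Sum>a\<in>A. Poly_Mapping.lookup c a)"
  unfolding coeff_sum_def by (intro sum.mono_neutral_left) (auto simp: in_keys_iff)

lemma coeff_sum_0 [simp]: "coeff_sum 0 = 0"
  by (simp add: coeff_sum_def)

lemma coeff_sum_frag_of [simp]: "coeff_sum (frag_of a) = 1"
  by (simp add: coeff_sum_def)

lemma coeff_sum_add: "coeff_sum (c + d) = coeff_sum c + coeff_sum d"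
  using coeff_sum_eq_sum[of "Poly_Mapping.keys c \<union> Poly_Mapping.keys d"] keys_add[of c d]
  by (simp add: lookup_add sum.distrib)

lemma coeff_sum_diff: "coeff_sum (c - d) = coeff_sum c - coeff_sum d"
  using coeff_sum_add[of "c - d" d] by simp

lemma coeff_sum_frag_extend_frag_of:
  "coeff_sum (frag_extend (\<lambda>a. frag_of (f a)) c) = coeff_sum c"
proof -
  have "Poly_Mapping.keys c \<subseteq> UNIV" by simp
  then show ?thesis
    by (induction c rule: frag_induction) (simp_all add: coeff_sum_diff frag_extend_diff)
qed

lemma coeff_sum_ge_lookup:
  "nonneg_chain c \<Longrightarrow> Poly_Mapping.lookup c i \<le> coeff_sum c"
  using coeff_sum_eq_sum[of "insert i (Poly_Mapping.keys c)" c]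
    member_le_sum[of i "insert i (Poly_Mapping.keys c)" "Poly_Mapping.lookup c"]
  by (metis finite_insert finite_keys insertI1 nonneg_chain_def subset_insertI DiffD1)

section \<open>Opetopic directed complexes\<close>

text \<open>Isolates what can be used before loop-freeness and unitality are known, so that
  \<open>loop_freeI\<close> and \<open>unitalI\<close> can establish these two properties for the
  complex built from a sequence.\<close>

locale single_output_complex =
  fixes K :: "'b thin_complex"
  assumes complex: "free_augmented_directed_complex K"
    and bdry_plus_single: "a \<in> basis K (Suc q) \<Longrightarrow> \<exists>b. bdry_plus K (frag_of a) = frag_of b"
begin

text \<open>Agrees with \<open>bdry K\<close> on each chain group (\<open>bdry_eq_D\<close>), but is
  linear on all chains, so no membership in a chain group has to be carried along.\<close>

definition D :: "('b \<Rightarrow>\<^sub>0 int) \<Rightarrow> ('b \<Rightarrow>\<^sub>0 int)" where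
  "D = frag_extend (\<lambda>a. bdry K (frag_of a))"

definition outs :: "'b \<Rightarrow> ('b \<Rightarrow>\<^sub>0 int)" where
  "outs a = bdry_plus K (frag_of a)"

definition ins :: "'b \<Rightarrow> ('b \<Rightarrow>\<^sub>0 int)" where
  "ins a = bdry_minus K (frag_of a)"

definition out :: "'b \<Rightarrow> 'b" where
  "out a = (THE b. outs a = frag_of b)"

lemma basis_disjoint: "a \<in> basis K p \<Longrightarrow> a \<in> basis K q \<Longrightarrow> p = q"
  using complex by (auto simp: free_augmented_directed_complex_def disjoint_family_on_def)

lemma D_diff: "D (c - c') = D c - D c'"
  by (simp add: D_def frag_extend_diff)

lemma D_frag_of: "D (frag_of a) = outs a - ins a"
  using bdry_plus_minus_iff[of "outs a" K "frag_of a" "ins a"]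
  by (simp add: D_def outs_def ins_def)

lemma D_eq_diff: "D c = frag_extend outs c - frag_extend ins c"
proof -
  have "Poly_Mapping.keys c \<subseteq> UNIV" by simp
  then show ?thesis
    by (induction c rule: frag_induction)
      (simp_all add: D_diff D_frag_of frag_extend_diff, simp add: D_def)
qed

lemma nonneg_outs [simp]: "nonneg_chain (outs a)"
  and nonneg_ins [simp]: "nonneg_chain (ins a)"
  by (simp_all add: nonneg_chain_def outs_def ins_def lookup_bdry_plus lookup_bdry_minus)

lemma bdry_hom: "bdry K \<in> hom (free_Abelian_group (basis K (Suc q))) (free_Abelian_group (basis K q))"
  using complex by (auto simp: free_augmented_directed_complex_def chain_group_def)

lemma bdry_0: "Poly_Mapping.keys c \<subseteq> basis K 0 \<Longrightarrow> bdry K c = 0"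
  using complex by (auto simp: free_augmented_directed_complex_def chain_group_def)

lemma bdry_eq_D:
  assumes "Poly_Mapping.keys c \<subseteq> basis K q"
  shows "bdry K c = D c"
proof (cases q)
  case 0
  with assms have "D c = 0"
    unfolding D_def by (intro frag_extend_eq_0 bdry_0) auto
  with 0 assms show ?thesis
    by (simp add: bdry_0)
next
  case (Suc p)
  have "bdry K 0 = 0"
    using hom_frag_diff[OF bdry_hom, of 0 _ 0] by simp
  from assms have "Poly_Mapping.keys c \<subseteq> basis K q \<and> bdry K c = D c"
    using \<open>bdry K 0 = 0\<close>
    by (induction c rule: frag_induction)
      (auto simp: D_def frag_extend_diff hom_frag_diff[OF bdry_hom] Suc dest: subsetD[OF keys_diff])
  then show ?thesis ..
qed

lemma keys_D:
  assumes "Poly_Mapping.keys c \<subseteq> basis K (Suc q)"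
  shows "Poly_Mapping.keys (D c) \<subseteq> basis K q"
  using hom_carrier[OF bdry_hom] assms bdry_eq_D[OF assms] by force

lemma keys_bdry_subset: "Poly_Mapping.keys (bdry_plus K c) \<union> Poly_Mapping.keys (bdry_minus K c) = Poly_Mapping.keys (bdry K c)"
  by (auto simp: in_keys_iff lookup_bdry_plus lookup_bdry_minus max_def split: if_splits)

lemma keys_outs: "a \<in> basis K (Suc q) \<Longrightarrow> Poly_Mapping.keys (outs a) \<subseteq> basis K q"
  and keys_ins: "a \<in> basis K (Suc q) \<Longrightarrow> Poly_Mapping.keys (ins a) \<subseteq> basis K q"
  using keys_D[of "frag_of a" q] bdry_eq_D[of "frag_of a" "Suc q"] keys_bdry_subset[of "frag_of a"]
  by (auto simp: outs_def ins_def)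

lemma DD:
  assumes "Poly_Mapping.keys c \<subseteq> basis K (Suc q)"
  shows "D (D c) = 0"
proof (cases q)
  case 0
  then show ?thesis
    using bdry_0[of "D c"] keys_D[OF assms] bdry_eq_D[of "D c" 0] by simp
next
  case (Suc p)
  have "bdry K (bdry K c) = 0"
    using complex assms Suc by (auto simp: free_augmented_directed_complex_def chain_group_def)
  then show ?thesis
    using bdry_eq_D[OF assms] bdry_eq_D[OF keys_D[OF assms]] by simp
qed

text \<open>This is \<open>\<partial>\<partial> = 0\<close> for
  \<open>D (frag_of a) = outs a - ins a\<close>: the two sides of \<open>a\<close> are parallel
  chains.\<close>

lemma D_outs_eq_D_ins: "a \<in> basis K (Suc q) \<Longrightarrow> D (outs a) = D (ins a)"
  using DD[of "frag_of a" q] by (simp add: D_frag_of D_diff)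

lemma
  assumes "a \<in> basis K (Suc q)"
  shows outs_eq: "outs a = frag_of (out a)" and out_in_basis: "out a \<in> basis K q"
proof -
  obtain b where b: "outs a = frag_of b"
    using bdry_plus_single[OF assms] by (auto simp: outs_def)
  then have "out a = b"
    unfolding out_def by (intro the_equality) (auto simp: frag_of_eq)
  with b show "outs a = frag_of (out a)" by simp
  then show "out a \<in> basis K q"
    using keys_outs[OF assms] by auto
qed

lemma D_out: "a \<in> basis K (Suc q) \<Longrightarrow> D (frag_of (out a)) = D (ins a)"
  using D_outs_eq_D_ins outs_eq by metis

lemma keys_boundary:
  "a \<in> basis K q \<Longrightarrow> Poly_Mapping.keys (D (frag_of a)) = Poly_Mapping.keys (outs a) \<union> Poly_Mapping.keys (ins a)"
  using bdry_eq_D[of "frag_of a" q] keys_bdry_subset[of "frag_of a"] by (simp add: outs_def ins_def)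

lemma funpow_out_in_basis: "a \<in> basis K (q + r) \<Longrightarrow> (out ^^ r) a \<in> basis K q"
  by (induction r arbitrary: q) (auto simp: out_in_basis simp flip: add_Suc)

lemma funpow_bdry_plus:
  "a \<in> basis K (q + r) \<Longrightarrow> (bdry_plus K ^^ r) (frag_of a) = frag_of ((out ^^ r) a)"
proof (induction r arbitrary: q)
  case (Suc r)
  then have "(out ^^ r) a \<in> basis K (Suc q)"
    by (intro funpow_out_in_basis) simp
  with Suc show ?case
    using outs_eq[of "(out ^^ r) a" q] Suc.IH[of "Suc q"] by (simp add: outs_def)
qed simp

text \<open>\<open>bdry_minus K\<close> depends only on the boundary of its argument, and
  \<open>ins b\<close> has the same boundary as \<open>out b\<close>. So every application of
  \<open>bdry_minus K\<close> but the last may be replaced by \<open>out\<close>.\<close>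

lemma funpow_bdry_minus:
  "a \<in> basis K (q + Suc r) \<Longrightarrow> (bdry_minus K ^^ Suc r) (frag_of a) = ins ((out ^^ r) a)"
proof (induction r arbitrary: q)
  case 0
  then show ?case by (simp add: ins_def)
next
  case (Suc r)
  let ?b = "(out ^^ r) a"
  have b: "?b \<in> basis K (Suc (Suc q))"
    using Suc.prems by (intro funpow_out_in_basis) simp
  have "(bdry_minus K ^^ Suc (Suc r)) (frag_of a) = bdry_minus K (ins ?b)"
    using Suc.IH[of "Suc q"] Suc.prems by simp
  moreover have "bdry K (ins ?b) = bdry K (frag_of (out ?b))"
    using D_out[OF b] bdry_eq_D[OF keys_ins[OF b]] bdry_eq_D[of "frag_of (out ?b)"] out_in_basis[OF b]
    by simp
  ultimately have "(bdry_minus K ^^ Suc (Suc r)) (frag_of a) = bdry_minus K (frag_of (out ?b))"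
    unfolding bdry_minus_def[of K "ins ?b"] bdry_minus_def[of K "frag_of (out ?b)"] by simp
  then show ?case
    by (simp add: ins_def)
qed

text \<open>After \<open>q\<close> steps the chain lies in degree 0, where boundaries vanish. This
  disposes of the large exponents \<open>r\<close> in the definition of
  \<open>loop_free\<close>.\<close>

lemma funpow_bdry_minus_eq_0:
  assumes "a \<in> basis K q" "q < r"
  shows "(bdry_minus K ^^ r) (frag_of a) = 0"
proof -
  have bdry_0_0: "bdry_minus K c = 0" if "Poly_Mapping.keys c \<subseteq> basis K 0" for c
    using bdry_0[OF that] by (intro poly_mapping_eqI) (simp add: lookup_bdry_minus)
  have "(bdry_minus K ^^ Suc q) (frag_of a) = 0"
  proof (cases q)
    case 0
    with assms show ?thesis by (simp add: bdry_0_0)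
  next
    case (Suc p)
    with assms have "(bdry_minus K ^^ Suc p) (frag_of a) = ins ((out ^^ p) a)"
      "(out ^^ p) a \<in> basis K (Suc 0)"
      using funpow_bdry_minus[of a 0 p] funpow_out_in_basis[of a "Suc 0" p] by simp_all
    with Suc show ?thesis
      using keys_ins[of "(out ^^ p) a" 0] by (simp add: bdry_0_0)
  qed
  moreover have "(bdry_minus K ^^ k) 0 = 0" for k
    by (induction k) (simp_all add: bdry_0_0)
  moreover have "r = (r - Suc q) + Suc q" using assms by simp
  ultimately show ?thesis
    by (metis comp_apply funpow_add)
qed

text \<open>Only \<open>r = 1\<close> needs checking: the \<open>r\<close>-fold boundaries of
  \<open>a\<close> are the simple boundaries of \<open>(out ^^ (r - 1)) a\<close>, and for
  \<open>r\<close> above the dimension of \<open>a\<close> there is no term on the minus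
  side.\<close>

lemma loop_freeI:
  assumes "partial_order_on (basis_elements K) R"
    and less: "\<And>a b q. a \<in> basis K (Suc q) \<Longrightarrow> b \<in> Poly_Mapping.keys (ins a) \<Longrightarrow> (b, out a) \<in> R \<and> b \<noteq> out a"
  shows "loop_free K"
  unfolding loop_free_def
proof (intro exI[of _ R] conjI[OF assms(1)] ballI allI impI)
  fix a r y z
  assume a: "a \<in> basis_elements K" and r: "0 < r"
    and y: "y \<in> Poly_Mapping.keys ((bdry_minus K ^^ r) (frag_of a))"
    and z: "z \<in> Poly_Mapping.keys ((bdry_plus K ^^ r) (frag_of a))"
  obtain q where q: "a \<in> basis K q" using a by (auto simp: basis_elements_def)
  have "r \<le> q" using y funpow_bdry_minus_eq_0[OF q, of r] by (cases "r \<le> q") auto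
  then obtain p where p: "q = p + r" by (metis add.commute le_Suc_ex)
  obtain k where k: "r = Suc k" using r by (cases r) auto
  have "(out ^^ k) a \<in> basis K (Suc p)"
    using q p k by (intro funpow_out_in_basis) simp
  moreover have "y \<in> Poly_Mapping.keys (ins ((out ^^ k) a))"
    using y funpow_bdry_minus[of a p k] q p k by simp
  moreover have "z = out ((out ^^ k) a)"
    using z funpow_bdry_plus[of a p r] q p k by simp
  ultimately show "(y, z) \<in> R \<and> y \<noteq> z"
    using less by blast
qed

lemma aug_hom: "aug K \<in> hom (free_Abelian_group (basis K 0)) integer_group"
  using complex by (auto simp: free_augmented_directed_complex_def chain_group_def)

lemma aug_diff:
  assumes "Poly_Mapping.keys c \<subseteq> basis K 0" "Poly_Mapping.keys d \<subseteq> basis K 0"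
  shows "aug K (c - d) = aug K c - aug K d"
proof -
  interpret group_hom "free_Abelian_group (basis K 0)" integer_group "aug K"
    by (simp add: group_hom_def group_hom_axioms_def aug_hom)
  have "Poly_Mapping.keys (c - d) \<subseteq> basis K 0"
    using keys_diff[of c d] assms by auto
  then show ?thesis
    using hom_mult[of "c - d" d] assms by simp
qed

text \<open>The iterated \<open>\<partial>\<^sup>+\<close> of \<open>a\<close> is a 0-dimensional
  basis element. In positive dimension the iterated \<open>\<partial>\<^sup>-\<close> is
  \<open>ins b\<close> for a 1-dimensional \<open>b\<close>, and
  \<open>\<epsilon>\<partial> = 0\<close> gives it the same augmentation as
  \<open>out b\<close>.\<close>

lemma unitalI:
  assumes aug: "\<And>a. a \<in> basis K 0 \<Longrightarrow> aug K (frag_of a) = 1"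
  shows "unital K"
  unfolding unital_def
proof (intro allI ballI conjI)
  fix q a assume a: "a \<in> basis K q"
  show "aug K ((bdry_plus K ^^ q) (frag_of a)) = 1"
    using funpow_bdry_plus[of a 0 q] funpow_out_in_basis[of a 0 q] a aug by simp
  show "aug K ((bdry_minus K ^^ q) (frag_of a)) = 1"
  proof (cases q)
    case 0
    with a aug show ?thesis by simp
  next
    case (Suc p)
    let ?b = "(out ^^ p) a"
    have b: "?b \<in> basis K (Suc 0)"
      using a Suc by (intro funpow_out_in_basis) simp
    have "aug K (bdry K (frag_of ?b)) = 0"
      using complex b by (auto simp: free_augmented_directed_complex_def chain_group_def)
    moreover have "bdry K (frag_of ?b) = outs ?b - ins ?b"
      using bdry_eq_D[of "frag_of ?b" "Suc 0"] b by (simp add: D_frag_of)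
    ultimately have "aug K (ins ?b) = aug K (outs ?b)"
      using aug_diff[OF keys_outs[OF b] keys_ins[OF b]] by simp
    then show ?thesis
      using funpow_bdry_minus[of a 0 p] a Suc outs_eq[OF b] aug[OF out_in_basis[OF b]] by simp
  qed
qed

end

locale opetopic_complex =
  fixes n :: nat and K :: "'b thin_complex"
  assumes opetopic: "opetopic_directed_complex n K"

sublocale opetopic_complex \<subseteq> single_output_complex K
proof
  show "free_augmented_directed_complex K"
    using opetopic by (simp add: opetopic_directed_complex_def)
  show "\<exists>b. bdry_plus K (frag_of a) = frag_of b" if "a \<in> basis K (Suc q)" for a q
    using opetopic that unfolding opetopic_directed_complex_def by blast
qed

context opetopic_complex
begin

lemma atomic: "atomic n K" and loop_free: "loop_free K" and unital: "unital K"
  using opetopic by (auto simp: opetopic_directed_complex_def)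

lemma aug_frag_of: "a \<in> basis K 0 \<Longrightarrow> aug K (frag_of a) = 1"
  using unital unfolding unital_def by force

lemma aug_eq:
  assumes "Poly_Mapping.keys c \<subseteq> basis K 0"
  shows "aug K c = coeff_sum c"
proof -
  have "aug K 0 = 0"
    using aug_diff[of 0 0] by simp
  have "Poly_Mapping.keys c \<subseteq> basis K 0 \<and> aug K c = coeff_sum c"
    using assms
    by (induction c rule: frag_induction)
      (auto simp: \<open>aug K 0 = 0\<close> aug_frag_of aug_diff coeff_sum_diff dest: subsetD[OF keys_diff])
  then show ?thesis ..
qed

lemma coeff_sum_D:
  assumes "Poly_Mapping.keys c \<subseteq> basis K (Suc 0)"
  shows "coeff_sum (D c) = 0"
proof -
  have "aug K (bdry K c) = 0"
    using complex assms by (auto simp: free_augmented_directed_complex_def chain_group_def)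
  then show ?thesis
    using aug_eq[OF keys_D[OF assms]] bdry_eq_D[OF assms] by simp
qed

lemma basis_above: "q > n \<Longrightarrow> basis K q = {}"
  using atomic by (auto simp: atomic_def)

lemma basis_top: "basis K n = {top_element n K}"
proof -
  have "\<exists>!g. g \<in> basis K n"
    using atomic by (auto simp: atomic_def)
  then show ?thesis
    unfolding top_element_def using theI'[of "\<lambda>g. g \<in> basis K n"] by blast
qed

text \<open>Atomicity offers some \<open>a\<close> of an arbitrary higher dimension; since
  boundaries lower the degree by exactly one and the bases are disjoint, that dimension is
  \<open>Suc q\<close>.\<close>

lemma basis_in_boundary:
  assumes "b \<in> basis K q" "q < n"
  shows "\<exists>a\<in>basis K (Suc q). b \<in> Poly_Mapping.keys (outs a) \<union> Poly_Mapping.keys (ins a)"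
proof -
  have "\<forall>q<n. \<forall>b\<in>basis K q. \<exists>p>q. \<exists>a\<in>basis K p.
      b \<in> Poly_Mapping.keys (ins a) \<or> b \<in> Poly_Mapping.keys (outs a)"
    using atomic by (simp add: atomic_def ins_def outs_def)
  then have "\<exists>p>q. \<exists>a\<in>basis K p. b \<in> Poly_Mapping.keys (ins a) \<or> b \<in> Poly_Mapping.keys (outs a)"
    using assms by simp
  then obtain p a where p: "p > q" "a \<in> basis K p" and
    ab: "b \<in> Poly_Mapping.keys (outs a) \<union> Poly_Mapping.keys (ins a)"
    by auto
  obtain p' where p': "p = Suc p'" using p by (cases p) auto
  then have "b \<in> basis K p'"
    using keys_outs[of a p'] keys_ins[of a p'] p ab by blast
  with assms have "p' = q"
    by (simp add: basis_disjoint)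
  with ab p p' show ?thesis by auto
qed

lemma finite_basis: "finite (basis K q)"
proof (induction "n - q" arbitrary: q)
  case 0
  then show ?case
    using basis_above[of q] basis_top by (cases "q = n") auto
next
  case (Suc m)
  have "basis K q \<subseteq> (\<Union>a\<in>basis K (Suc q). Poly_Mapping.keys (outs a) \<union> Poly_Mapping.keys (ins a))"
    using basis_in_boundary[of _ q] Suc(2) by auto
  moreover have "finite (basis K (Suc q))"
    using Suc by simp
  ultimately show ?case
    by (auto intro: finite_subset)
qed

text \<open>The basis is finite, so counting predecessors in the order from \<open>loop_free\<close>
  is strictly monotone. A natural number rank gives maxima, minima and well-founded induction
  directly.\<close>

lemma ex_rank:
  "\<exists>rk :: 'b \<Rightarrow> nat. \<forall>q. \<forall>a\<in>basis K (Suc q). \<forall>b\<in>Poly_Mapping.keys (ins a). rk b < rk (out a)"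
proof -
  obtain R where R: "partial_order_on (basis_elements K) R" and
    less: "\<forall>a\<in>basis_elements K. \<forall>r>0.
       \<forall>x\<in>Poly_Mapping.keys ((bdry_minus K ^^ r) (frag_of a)).
       \<forall>y\<in>Poly_Mapping.keys ((bdry_plus K ^^ r) (frag_of a)). (x, y) \<in> R \<and> x \<noteq> y"
    using loop_free unfolding loop_free_def by (elim exE conjE)
  have "basis_elements K \<subseteq> (\<Union>q\<in>{..n}. basis K q)"
  proof
    fix x assume "x \<in> basis_elements K"
    then obtain q where "x \<in> basis K q" by (auto simp: basis_elements_def)
    then show "x \<in> (\<Union>q\<in>{..n}. basis K q)"
      using basis_above[of q] by (cases "q \<le> n") auto
  qed
  then have fin: "finite (basis_elements K)"
    by (rule finite_subset) (auto intro: finite_basis)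
  define rk where "rk x = card {z \<in> basis_elements K. (z, x) \<in> R}" for x
  have "rk b < rk (out a)" if a: "a \<in> basis K (Suc q)" and b: "b \<in> Poly_Mapping.keys (ins a)" for q a b
  proof -
    have "a \<in> basis_elements K"
      using a by (auto simp: basis_elements_def)
    then have ba: "(b, out a) \<in> R" "b \<noteq> out a"
      using less[rule_format, of a 1 b "out a"] b outs_eq[OF a]
      by (simp_all add: ins_def outs_def)
    have "out a \<in> basis_elements K"
      using out_in_basis[OF a] by (auto simp: basis_elements_def)
    moreover have "(out a, out a) \<in> R" "trans R" "antisym R"
      using R \<open>out a \<in> basis_elements K\<close>
      by (auto simp: partial_order_on_def preorder_on_def refl_on_def)
    ultimately have "{z \<in> basis_elements K. (z, b) \<in> R} \<subset> {z \<in> basis_elements K. (z, out a) \<in> R}"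
      using ba by (auto dest: transD antisymD)
    then show ?thesis
      unfolding rk_def using fin by (intro psubset_card_mono) auto
  qed
  then show ?thesis by blast
qed

section \<open>Absence of repeated terms in chains with the boundary of a basis element\<close>

definition rk :: "'b \<Rightarrow> nat" where
  "rk = (SOME rk. \<forall>q. \<forall>a\<in>basis K (Suc q). \<forall>b\<in>Poly_Mapping.keys (ins a). rk b < rk (out a))"

lemma rk_less: "a \<in> basis K (Suc q) \<Longrightarrow> b \<in> Poly_Mapping.keys (ins a) \<Longrightarrow> rk b < rk (out a)"
  using someI_ex[OF ex_rank] unfolding rk_def by blast

text \<open>In degree 0 every boundary is zero, so comparing boundaries would say nothing; there
  total coefficient 1 takes its place.\<close>

definition good :: "nat \<Rightarrow> ('b \<Rightarrow>\<^sub>0 int) \<Rightarrow> bool" where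
  "good q c \<longleftrightarrow> Poly_Mapping.keys c \<subseteq> basis K q \<and> nonneg_chain c \<and>
     (if q = 0 then coeff_sum c = 1 else \<exists>b\<in>basis K q. D c = D (frag_of b))"

lemma good_frag_of: "b \<in> basis K q \<Longrightarrow> good q (frag_of b)"
  by (auto simp: good_def)

text \<open>Subtracting a boundary changes neither the boundary nor, in degree 0, the coefficient
  sum. For \<open>a = frag_of b\<close> this replaces the edge \<open>out b\<close> by the edges
  \<open>ins b\<close>.\<close>

lemma good_diff_D:
  assumes "good q c" "Poly_Mapping.keys a \<subseteq> basis K (Suc q)" "nonneg_chain (c - D a)"
  shows "good q (c - D a)"
proof -
  have "Poly_Mapping.keys (c - D a) \<subseteq> basis K q"
    using assms(1) keys_D[OF assms(2)] keys_diff[of c "D a"] by (auto simp: good_def)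
  with assms show ?thesis
    using coeff_sum_D[of a] DD[of a q] by (auto simp: good_def coeff_sum_diff D_diff)
qed

text \<open>Here \<open>c\<close> is expanded into \<open>z\<close> through the vertices of
  \<open>y\<close>, and the bounded chain is the sum of all edges met on the way. The induction
  removes one vertex at a time; \<open>P\<close> bounds each intermediate chain.\<close>

lemma lookup_le_1_expansion:
  assumes P: "\<And>c i. good q c \<Longrightarrow> Poly_Mapping.lookup c i \<le> 1"
    and "nonneg_chain y" "Poly_Mapping.keys y \<subseteq> basis K (Suc q)" "good q c" "nonneg_chain z"
      "D y = c - z"
  shows "Poly_Mapping.lookup (z + frag_extend outs y) i \<le> 1"
  using assms(2-)
proof (induction "nat (coeff_sum y)" arbitrary: y c)
  case 0
  have "Poly_Mapping.lookup y j = 0" for j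
    using coeff_sum_ge_lookup[OF 0(2), of j] 0(1,2) by (auto simp: nonneg_chain_def intro: antisym)
  then have "y = 0"
    by (intro poly_mapping_eqI) auto
  with 0 show ?case
    using P[of c] by (simp add: D_def)
next
  case (Suc m)
  note y = \<open>nonneg_chain y\<close> and keys_y = \<open>Poly_Mapping.keys y \<subseteq> basis K (Suc q)\<close>
    and c = \<open>good q c\<close> and z = \<open>nonneg_chain z\<close> and Dy = \<open>D y = c - z\<close>
  have "y \<noteq> 0" using Suc(2) by auto
  then have "Poly_Mapping.keys y \<noteq> {}" by simp
  then obtain a where a: "a \<in> Poly_Mapping.keys y"
    and max: "\<And>b. b \<in> Poly_Mapping.keys y \<Longrightarrow> rk (out b) \<le> rk (out a)"
    using obtains_MAX[of "Poly_Mapping.keys y" "\<lambda>b. rk (out b)"]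
    by (metis (no_types, lifting) Max_ge finite_imageI finite_keys imageI)
  have aq: "a \<in> basis K (Suc q)" using a keys_y by auto
  \<comment> \<open>An input of \<open>b\<close> has smaller rank than \<open>out b\<close>, so an
    output of maximal rank is an input of no vertex of \<open>y\<close>.\<close>
  have notin: "out a \<notin> Poly_Mapping.keys (ins b)" if "b \<in> Poly_Mapping.keys y" for b
    using rk_less[of b q "out a"] max[OF that] that keys_y by auto
  \<comment> \<open>Both sides sum the same edges: on the left leaves and outputs of vertices, on
    the right the edges of \<open>c\<close> and inputs of vertices.\<close>
  have eq: "z + frag_extend outs y = c + frag_extend ins y"
    using Dy unfolding D_eq_diff by (simp add: algebra_simps)
  have ins0: "Poly_Mapping.lookup (frag_extend ins y) (out a) = 0"
    using notin by (simp add: lookup_frag_extend in_keys_iff)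
  have ge: "1 \<le> Poly_Mapping.lookup (frag_extend outs y) (out a)"
    using lookup_le_lookup_frag_extend[OF y, of outs a "out a"] a y outs_eq[OF aq]
    by (simp add: in_keys_nonneg_iff)
  have le1: "Poly_Mapping.lookup (z + frag_extend outs y) (out a) \<le> 1"
    unfolding eq using P[OF c, of "out a"] ins0 by (simp add: lookup_add)
  \<comment> \<open>No vertex uses up \<open>out a\<close>, so it must already occur in
    \<open>c\<close> and can be expanded there.\<close>
  have "1 \<le> Poly_Mapping.lookup c (out a)"
    using arg_cong[OF eq, of "\<lambda>c. Poly_Mapping.lookup c (out a)"] ge ins0 z
    by (auto simp: lookup_add nonneg_chain_def dest!: spec[of _ "out a"])
  moreover have "nonneg_chain c" using c by (simp add: good_def)
  ultimately have "nonneg_chain (c - frag_of (out a))"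
    by (intro nonneg_chain_diff_frag_of) (auto simp: in_keys_nonneg_iff)
  then have "nonneg_chain (c - frag_of (out a) + ins a)"
    by (intro nonneg_chain_add) auto
  moreover have c': "c - frag_of (out a) + ins a = c - D (frag_of a)"
    by (simp add: D_frag_of outs_eq[OF aq])
  ultimately have "good q (c - D (frag_of a))"
    using c aq by (intro good_diff_D) auto
  moreover have "Poly_Mapping.keys (y - frag_of a) \<subseteq> basis K (Suc q)"
    using keys_y a keys_diff[of y "frag_of a"] by auto
  moreover have "m = nat (coeff_sum (y - frag_of a))"
    using Suc(2) by (simp add: coeff_sum_diff)
  \<comment> \<open>Dropping \<open>a\<close> from \<open>y\<close> alters the edge sum only at
    \<open>out a\<close>, and that coefficient is bounded by \<open>le1\<close>.\<close>
  ultimately have IH: "Poly_Mapping.lookup (z + frag_extend outs (y - frag_of a)) i \<le> 1"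
    using nonneg_chain_diff_frag_of[OF y a] z Dy by (intro Suc(1)) (auto simp: D_diff)
  show ?case
  proof (cases "i = out a")
    case True
    with le1 show ?thesis by simp
  next
    case False
    with IH show ?thesis
      by (simp add: lookup_add lookup_minus frag_extend_diff outs_eq[OF aq])
  qed
qed

lemma lookup_le_lookup_frag_extend_outs:
  assumes "nonneg_chain y" "Poly_Mapping.keys y \<subseteq> basis K (Suc q)"
  shows "a \<in> Poly_Mapping.keys y \<Longrightarrow>
    Poly_Mapping.lookup y a \<le> Poly_Mapping.lookup (frag_extend outs y) (out a)"
  using lookup_le_lookup_frag_extend[OF assms(1), of outs a "out a"] assms(2) outs_eq[of a q] by auto

lemma good_outs: "a \<in> basis K (Suc q) \<Longrightarrow> good q (outs a)"
  by (simp add: outs_eq good_frag_of out_in_basis)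

text \<open>Induction on the degree. If \<open>c\<close> is parallel to \<open>b\<close>, then
  \<open>c\<close> expands \<open>outs b\<close> into \<open>ins b\<close> one degree lower; a
  repeated term \<open>i\<close> of \<open>c\<close> would make \<open>out i\<close> a repeated edge
  there.\<close>

lemma good_lookup_le_1: "good q c \<Longrightarrow> Poly_Mapping.lookup c i \<le> 1"
proof (induction q arbitrary: c i)
  case 0
  then show ?case
    using coeff_sum_ge_lookup[of c i] by (auto simp: good_def)
next
  case (Suc q)
  then obtain b where c: "Poly_Mapping.keys c \<subseteq> basis K (Suc q)" "nonneg_chain c"
    and b: "b \<in> basis K (Suc q)" "D c = D (frag_of b)"
    by (auto simp: good_def)
  have le: "Poly_Mapping.lookup (ins b + frag_extend outs c) j \<le> 1" for j
    using c b good_outs[OF b(1)]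
    by (intro lookup_le_1_expansion[OF Suc(1), of q]) (auto simp: D_frag_of)
  show ?case
  proof (cases "i \<in> Poly_Mapping.keys c")
    case True
    have "Poly_Mapping.lookup c i \<le> Poly_Mapping.lookup (frag_extend outs c) (out i)"
      using lookup_le_lookup_frag_extend_outs[OF c(2,1) True] .
    also have "\<dots> \<le> Poly_Mapping.lookup (ins b + frag_extend outs c) (out i)"
      using nonneg_ins[of b] by (simp add: lookup_add nonneg_chain_def)
    finally show ?thesis using le[of "out i"] by simp
  qed (simp add: in_keys_iff)
qed

lemma good_ins:
  assumes "a \<in> basis K (Suc q)"
  shows "good q (ins a)"
proof -
  have "ins a = outs a - D (frag_of a)"
    by (simp add: D_frag_of)
  then show ?thesis
    using good_diff_D[OF good_outs[OF assms], of "frag_of a"] assms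
    by (metis keys_frag_of nonneg_ins empty_subsetI insert_subset)
qed

text \<open>If \<open>ins a\<close> were zero, so would be the iterated
  \<open>\<partial>\<^sup>-\<close> of \<open>a\<close>, which has augmentation 1 by
  unitality.\<close>

lemma ins_nonzero:
  assumes a: "a \<in> basis K (Suc q)"
  shows "ins a \<noteq> 0"
proof -
  have "aug K ((bdry_minus K ^^ Suc q) (frag_of a)) = 1"
    using unital a unfolding unital_def by blast
  moreover have "(bdry_minus K ^^ Suc q) (frag_of a) = (bdry_minus K ^^ q) (ins a)"
    by (simp add: funpow_swap1 ins_def)
  moreover have "bdry_minus K 0 = 0"
    using bdry_eq_D[of 0 0] by (intro poly_mapping_eqI) (simp add: lookup_bdry_minus D_def)
  then have "(bdry_minus K ^^ q) 0 = 0"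
    by (induction q) auto
  moreover have "aug K 0 = 0"
    using aug_eq[of 0] by simp
  ultimately show ?thesis by auto
qed

section \<open>The chains \<open>x\<close> and \<open>g\<close>, with \<open>root q\<close> as the
  single term of \<open>x\<close> on the plus side\<close>

definition root :: "nat \<Rightarrow> 'b" where
  "root q = (out ^^ (n - q)) (top_element n K)"

abbreviation x :: "nat \<Rightarrow> ('b \<Rightarrow>\<^sub>0 int)" where
  "x \<equiv> x_minus n K"

abbreviation g :: "nat \<Rightarrow> ('b \<Rightarrow>\<^sub>0 int)" where
  "g \<equiv> g_minus n K"

lemma root_top [simp]: "root n = top_element n K"
  by (simp add: root_def)

lemma root_eq_out: "q < n \<Longrightarrow> root q = out (root (Suc q))"
  using Suc_diff_Suc[of q n] by (simp add: root_def flip: Suc_diff_Suc)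

lemma root_in_basis: "q \<le> n \<Longrightarrow> root q \<in> basis K q"
proof (induction rule: inc_induct)
  case base
  then show ?case using basis_top by simp
next
  case (step q)
  then show ?case using root_eq_out out_in_basis by simp
qed

lemma x_eq_ins:
  assumes "q < n"
  shows "x q = ins (root (Suc q))"
proof -
  have "n = q + Suc (n - Suc q)" using assms by simp
  then show ?thesis
    using funpow_bdry_minus[of "top_element n K" q "n - Suc q"] basis_top assms
    by (simp add: x_minus_def root_def Suc_diff_Suc)
qed

lemma x_top: "x n = frag_of (root n)"
  by (simp add: x_minus_def)

lemma x_above: "q > n \<Longrightarrow> x q = 0"
  by (simp add: x_minus_def)

lemma good_x: "q \<le> n \<Longrightarrow> good q (x q)"
  using good_ins[OF root_in_basis[of "Suc q"]] x_eq_ins x_top good_frag_of[OF root_in_basis[of n]]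
  by (cases "q = n") (auto simp del: root_top)

lemma nonneg_x: "nonneg_chain (x q)"
  using good_x[of q] x_above[of q] by (cases "q \<le> n") (auto simp: good_def)

lemma keys_x: "Poly_Mapping.keys (x q) \<subseteq> basis K q"
  using good_x[of q] x_above[of q] by (cases "q \<le> n") (auto simp: good_def)

lemma in_basis_if_in_keys_x: "a \<in> Poly_Mapping.keys (x q) \<Longrightarrow> a \<in> basis K q"
  using keys_x by auto

lemma keys_outs_eq: "a \<in> Poly_Mapping.keys (x (Suc q)) \<Longrightarrow> Poly_Mapping.keys (outs a) = {out a}"
  using outs_eq[OF in_basis_if_in_keys_x] by simp

text \<open>\<open>x (Suc q)\<close> and \<open>root (Suc q)\<close> are parallel: they coincide for
  \<open>Suc q = n\<close>, and otherwise are the two sides of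
  \<open>root (Suc (Suc q))\<close>.\<close>

lemma D_x:
  assumes "q < n"
  shows "D (x (Suc q)) = frag_of (root q) - x q"
proof -
  have "D (x (Suc q)) = D (frag_of (root (Suc q)))"
  proof (cases "Suc q = n")
    case True
    then show ?thesis using x_top by simp
  next
    case False
    then have "root (Suc (Suc q)) \<in> basis K (Suc (Suc q))"
      using assms root_in_basis by simp
    from D_outs_eq_D_ins[OF this] outs_eq[OF this] show ?thesis
      using False assms x_eq_ins[of "Suc q"] root_eq_out[of "Suc q"] by simp
  qed
  also have "\<dots> = frag_of (root q) - x q"
    using assms root_in_basis[of "Suc q"]
    by (simp add: D_frag_of outs_eq[of _ q] x_eq_ins root_eq_out)
  finally show ?thesis .
qed

lemma g_eq: "g q = x q + frag_extend outs (x (Suc q))"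
  by (simp add: g_minus_def outs_def[abs_def])

text \<open>The definition of \<open>g\<close> lists edges by their sources; \<open>D_x\<close>
  converts this into a list by their targets, in which the root is the one edge without a
  target.\<close>

lemma g_eq_ins: "q < n \<Longrightarrow> g q = frag_of (root q) + frag_extend ins (x (Suc q))"
  using D_x[of q] by (simp add: g_eq D_eq_diff algebra_simps)

lemma g_top: "g n = frag_of (root n)"
  using x_top x_above[of "Suc n"] by (simp add: g_eq)

lemma lookup_g_le_1:
  assumes "q \<le> n"
  shows "Poly_Mapping.lookup (g q) e \<le> 1"
proof (cases "q = n")
  case True
  then show ?thesis by (simp add: g_top)
next
  case False
  then show ?thesis
    using assms root_in_basis[of q] unfolding g_eq
    \<comment> \<open>The root is expanded into the leaves \<open>x q\<close> through the vertices
      \<open>x (Suc q)\<close>.\<close>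
    by (intro lookup_le_1_expansion[of q _ "frag_of (root q)"])
      (auto simp: good_lookup_le_1 nonneg_x keys_x D_x good_frag_of)
qed

lemma keys_g: "Poly_Mapping.keys (g q) = Poly_Mapping.keys (x q) \<union> out ` Poly_Mapping.keys (x (Suc q))"
proof -
  show ?thesis
    by (auto simp: keys_outs_eq g_eq keys_add_nonneg keys_frag_extend_nonneg nonneg_x nonneg_chain_frag_extend)
qed

lemma keys_g_ins:
  assumes "q \<le> n"
  shows "Poly_Mapping.keys (g q) =
    insert (root q) (\<Union>a\<in>Poly_Mapping.keys (x (Suc q)). Poly_Mapping.keys (ins a))"
proof (cases "q = n")
  case True
  then show ?thesis by (simp add: g_top x_above)
next
  case False
  then show ?thesis
    using assms
    by (simp add: g_eq_ins keys_add_nonneg keys_frag_extend_nonneg nonneg_x nonneg_chain_frag_extend)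
qed

lemma lookup_frag_extend_outs_le_1: "Poly_Mapping.lookup (frag_extend outs (x (Suc q))) e \<le> 1"
proof (cases "q \<le> n")
  case True
  from lookup_g_le_1[OF True, of e] nonneg_x[of q] show ?thesis
    by (auto simp: g_eq lookup_add nonneg_chain_def dest!: spec[of _ e])
qed (simp add: x_above)

lemma lookup_frag_extend_ins_le_1: "Poly_Mapping.lookup (frag_extend ins (x (Suc q))) e \<le> 1"
proof (cases "q < n")
  case True
  from lookup_g_le_1[of q e] True show ?thesis
    by (auto simp: g_eq_ins lookup_add split: if_splits)
qed (simp add: x_above)

text \<open>Two vertices with one output would give that edge coefficient at least 2. Hence the
  description defining \<open>src\<close> in \<open>G_minus\<close> is unique.\<close>

lemma inj_on_out: "inj_on out (Poly_Mapping.keys (x (Suc q)))"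
proof (rule inj_onI)
  fix a b
  assume ab: "a \<in> Poly_Mapping.keys (x (Suc q))" "b \<in> Poly_Mapping.keys (x (Suc q))" "out a = out b"
  then have "out a \<in> Poly_Mapping.keys (outs a)" "out a \<in> Poly_Mapping.keys (outs b)"
    by (simp_all add: keys_outs_eq)
  with ab show "a = b"
    using disjoint_keys_if_lookup_frag_extend_le_1[OF nonneg_x _ lookup_frag_extend_outs_le_1] by auto
qed

lemma ins_disjoint:
  "a \<in> Poly_Mapping.keys (x (Suc q)) \<Longrightarrow> b \<in> Poly_Mapping.keys (x (Suc q)) \<Longrightarrow>
   e \<in> Poly_Mapping.keys (ins a) \<Longrightarrow> e \<in> Poly_Mapping.keys (ins b) \<Longrightarrow> a = b"
  using disjoint_keys_if_lookup_frag_extend_le_1[OF nonneg_x _ lookup_frag_extend_ins_le_1] by auto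

text \<open>Such an edge would be counted twice in \<open>g q\<close>. So terms of
  \<open>x q\<close> have no source, which makes them exactly the input edges.\<close>

lemma out_not_in_x:
  assumes "a \<in> Poly_Mapping.keys (x (Suc q))"
  shows "out a \<notin> Poly_Mapping.keys (x q)"
proof
  assume "out a \<in> Poly_Mapping.keys (x q)"
  then have "1 \<le> Poly_Mapping.lookup (x q) (out a)"
    by (simp add: in_keys_nonneg_iff nonneg_x)
  moreover have "1 \<le> Poly_Mapping.lookup (x (Suc q)) a"
    using assms by (simp add: in_keys_nonneg_iff nonneg_x)
  moreover have "Poly_Mapping.lookup (x (Suc q)) a \<le> Poly_Mapping.lookup (frag_extend outs (x (Suc q))) (out a)"
    using lookup_le_lookup_frag_extend_outs[OF nonneg_x keys_x assms] .
  moreover have "q \<le> n" using assms x_above[of "Suc q"] by (cases "q \<le> n") auto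
  then have "Poly_Mapping.lookup (g q) (out a) \<le> 1" by (rule lookup_g_le_1)
  ultimately show False by (simp add: g_eq lookup_add)
qed

lemma root_not_in_ins:
  assumes "q \<le> n" "a \<in> Poly_Mapping.keys (x (Suc q))"
  shows "root q \<notin> Poly_Mapping.keys (ins a)"
proof
  assume root: "root q \<in> Poly_Mapping.keys (ins a)"
  have "q < n" using assms x_above[of "Suc q"] by (cases "q < n") auto
  have "root q \<in> Poly_Mapping.keys (frag_extend ins (x (Suc q)))"
    using root assms by (auto simp: keys_frag_extend_nonneg nonneg_x)
  then have "1 \<le> Poly_Mapping.lookup (frag_extend ins (x (Suc q))) (root q)"
    by (simp add: in_keys_nonneg_iff nonneg_x nonneg_chain_frag_extend)
  with lookup_g_le_1[OF assms(1), of "root q"] \<open>q < n\<close> show False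
    by (simp add: g_eq_ins lookup_add)
qed

section \<open>The associated networks in terms of \<open>ins\<close>, \<open>out\<close> and
  \<open>root\<close>\<close>

lemma edges_G: "edges (G_minus n K q) = Poly_Mapping.keys (g q)"
  and vertices_G: "vertices (G_minus n K q) = Poly_Mapping.keys (x (Suc q))"
  and thin_edges_G: "thin_edges (G_minus n K q) = Poly_Mapping.keys (g q) \<inter> thin K"
  and thin_vertices_G: "thin_vertices (G_minus n K q) = Poly_Mapping.keys (x (Suc q)) \<inter> thin K"
  by (simp_all add: G_minus_def Let_def)

lemma inputs_G: "inputs (G_minus n K q) = Poly_Mapping.keys (x q)"
  using out_not_in_x[of _ q] keys_outs_eq[of _ q] keys_g[of q]
  by (auto simp: G_minus_def Let_def simp flip: outs_def ins_def)

lemma outputs_G: "q \<le> n \<Longrightarrow> outputs (G_minus n K q) = {root q}"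
  using keys_g_ins[of q] root_not_in_ins[of q]
  by (auto simp: G_minus_def Let_def simp flip: outs_def ins_def)

lemma src_G:
  assumes "a \<in> Poly_Mapping.keys (x (Suc q))"
  shows "src (G_minus n K q) (out a) = a"
  unfolding G_minus_def Let_def using assms inj_onD[OF inj_on_out[of q]]
  by (auto simp: keys_outs_eq simp flip: outs_def ins_def intro!: the_equality)

lemma tgt_G:
  assumes "a \<in> Poly_Mapping.keys (x (Suc q))" "e \<in> Poly_Mapping.keys (ins a)"
  shows "tgt (G_minus n K q) e = a"
proof -
  have "(THE v. v \<in> Poly_Mapping.keys (x (Suc q)) \<and> e \<in> Poly_Mapping.keys (ins v)) = a"
    using assms ins_disjoint by (intro the_equality) blast+
  then show ?thesis
    by (simp add: G_minus_def ins_def Let_def)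
qed

lemma nonoutputs_G: "q \<le> n \<Longrightarrow> edges (G_minus n K q) - outputs (G_minus n K q) =
    (\<Union>a\<in>Poly_Mapping.keys (x (Suc q)). Poly_Mapping.keys (ins a))"
  using root_not_in_ins by (auto simp: edges_G outputs_G keys_g_ins)

lemma noninputs_G: "edges (G_minus n K q) - inputs (G_minus n K q) = out ` Poly_Mapping.keys (x (Suc q))"
  using out_not_in_x by (auto simp: edges_G inputs_G keys_g)

lemma keys_ins_G:
  assumes "q \<le> n" "a \<in> Poly_Mapping.keys (x (Suc q))"
  shows "Poly_Mapping.keys (ins a) =
    {e \<in> edges (G_minus n K q) - outputs (G_minus n K q). tgt (G_minus n K q) e = a}"
  unfolding nonoutputs_G[OF assms(1)] using assms tgt_G by auto

lemma keys_g_subset_basis: "Poly_Mapping.keys (g q) \<subseteq> basis K q"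
  using keys_x out_in_basis by (auto simp: keys_g)

text \<open>Induction up the tree from its leaves, well-founded because the inputs of a vertex have
  smaller rank than its output. It extends facts from the terms of \<open>x q\<close> to all
  edges.\<close>

lemma keys_g_induct [consumes 2, case_names input out]:
  assumes "a \<in> Poly_Mapping.keys (g q)" "q \<le> n"
    and "\<And>a. a \<in> Poly_Mapping.keys (x q) \<Longrightarrow> P a"
    and "\<And>v. v \<in> Poly_Mapping.keys (x (Suc q)) \<Longrightarrow> (\<And>a. a \<in> Poly_Mapping.keys (ins v) \<Longrightarrow> P a) \<Longrightarrow> P (out v)"
  shows "P a"
  using assms(1)
proof (induction "rk a" arbitrary: a rule: less_induct)
  case less
  then consider "a \<in> Poly_Mapping.keys (x q)" | v where "v \<in> Poly_Mapping.keys (x (Suc q))" "a = out v"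
    by (auto simp: keys_g)
  then show ?case
  proof cases
    case (2 v)
    have "P b" if "b \<in> Poly_Mapping.keys (ins v)" for b
    proof (rule less.hyps)
      show "rk b < rk a"
        using 2 that keys_x by (auto intro: rk_less)
      show "b \<in> Poly_Mapping.keys (g q)"
        using 2 that \<open>q \<le> n\<close> by (auto simp: keys_g_ins)
    qed
    with 2 assms(4) show ?thesis by blast
  qed (rule assms(3))
qed

text \<open>For a leaf both sides of the boundary are read off from the vertex it gives in degree
  \<open>q\<close>. For \<open>out v\<close> the boundary equals that of \<open>ins v\<close>, to
  whose terms the induction hypothesis applies.\<close>

lemma keys_D_subset_keys_g:
  assumes "a \<in> Poly_Mapping.keys (g (Suc q))" "Suc q \<le> n"
  shows "Poly_Mapping.keys (D (frag_of a)) \<subseteq> Poly_Mapping.keys (g q)"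
  using assms
proof (induction rule: keys_g_induct)
  case (input a)
  then have "Poly_Mapping.keys (D (frag_of a)) = insert (out a) (Poly_Mapping.keys (ins a))"
    by (simp add: keys_boundary[OF in_basis_if_in_keys_x] keys_outs_eq)
  moreover have "out a \<in> Poly_Mapping.keys (g q)"
    using input by (simp add: keys_g)
  moreover have "Poly_Mapping.keys (ins a) \<subseteq> Poly_Mapping.keys (g q)"
    using input assms(2) by (auto simp: keys_g_ins)
  ultimately show ?case by simp
next
  case (out v)
  then have v: "v \<in> basis K (Suc (Suc q))" using keys_x by auto
  have "Poly_Mapping.keys (D (frag_of (out v))) = Poly_Mapping.keys (D (ins v))"
    using v by (simp add: D_out)
  also have "\<dots> \<subseteq> (\<Union>a\<in>Poly_Mapping.keys (ins v). Poly_Mapping.keys (D (frag_of a)))"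
    using keys_frag_extend[of "\<lambda>a. bdry K (frag_of a)" "ins v"] by (simp add: D_def)
  finally show ?case using out by auto
qed

text \<open>Downward induction from \<open>n\<close>: by atomicity each basis element is in the
  boundary of one in the next degree, and such boundaries stay inside the network.\<close>

lemma basis_eq_keys_g: "q \<le> n \<Longrightarrow> basis K q = Poly_Mapping.keys (g q)"
proof (induction rule: inc_induct)
  case base
  then show ?case by (simp add: g_top basis_top)
next
  case (step q)
  have "basis K q \<subseteq> Poly_Mapping.keys (g q)"
  proof
    fix b assume "b \<in> basis K q"
    then obtain a where a: "a \<in> basis K (Suc q)" "b \<in> Poly_Mapping.keys (D (frag_of a))"
      using basis_in_boundary[of b q] step(2) keys_boundary[of _ "Suc q"] by blast
    with step keys_D_subset_keys_g[of a q] show "b \<in> Poly_Mapping.keys (g q)"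
      by auto
  qed
  with keys_g_subset_basis[of q] show ?case by auto
qed

lemma ins_eq_frag_of:
  assumes "a \<in> basis K (Suc q)" "Poly_Mapping.keys (ins a) = {b}"
  shows "ins a = frag_of b"
  using chain_eq_sum_keys[OF nonneg_ins good_lookup_le_1[OF good_ins[OF assms(1)]]] assms(2) by simp

text \<open>
  In a subtree with a single leaf \<open>b\<close>, the vertex whose output is minimal has \<open>b\<close> as its only input.
\<close>

lemma ex_vertex_ins_eq:
  assumes "a \<in> Poly_Mapping.keys (g (Suc q))" "Suc q \<le> n" "ins a = frag_of b"
  shows "\<exists>v\<in>Poly_Mapping.keys (x (Suc q)). ins v = frag_of b"
  using assms
proof (induction rule: keys_g_induct)
  case (input a)
  then show ?case by blast
next
  case (out v)
  then have v: "v \<in> basis K (Suc (Suc q))" using keys_x by auto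
  then have ov: "out v \<in> basis K (Suc q)" by (rule out_in_basis)
  have "Poly_Mapping.keys (ins v) \<noteq> {}"
    using ins_nonzero[OF v] by simp
  then obtain a where a: "a \<in> Poly_Mapping.keys (ins v)"
    and min: "\<And>b. b \<in> Poly_Mapping.keys (ins v) \<Longrightarrow> rk (out a) \<le> rk (out b)"
    using ex_min_if_finite[of "(\<lambda>b. rk (out b)) ` Poly_Mapping.keys (ins v)"]
    by (auto simp: not_less)
  have ins_v: "Poly_Mapping.keys (ins v) \<subseteq> basis K (Suc q)"
    using keys_ins[OF v] .
  have aq: "a \<in> basis K (Suc q)"
    using a ins_v by auto
  have "e = b" if e: "e \<in> Poly_Mapping.keys (ins a)" for e
  proof (rule ccontr)
    assume "e \<noteq> b"
    \<comment> \<open>By minimality of \<open>out a\<close>, nothing in \<open>ins v\<close>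
      produces \<open>e\<close>, so \<open>e\<close> keeps a negative coefficient in
      \<open>D (ins v)\<close>, whose only negative term is \<open>b\<close>.\<close>
    have "e \<noteq> out c" if "c \<in> Poly_Mapping.keys (ins v)" for c
      using rk_less[OF aq e] min[OF that] by auto
    then have "Poly_Mapping.lookup (frag_extend outs (ins v)) e = 0"
      unfolding lookup_frag_extend using ins_v by (intro sum.neutral ballI) (auto simp: outs_eq)
    moreover have "e \<in> Poly_Mapping.keys (frag_extend ins (ins v))"
      using a e by (auto simp: keys_frag_extend_nonneg)
    then have "1 \<le> Poly_Mapping.lookup (frag_extend ins (ins v)) e"
      by (simp add: in_keys_nonneg_iff nonneg_chain_frag_extend)
    ultimately have "Poly_Mapping.lookup (D (ins v)) e < 0"
      by (simp add: D_eq_diff lookup_minus)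
    moreover have "D (ins v) = frag_of (out (out v)) - frag_of b"
      using D_out[OF v] out(3) ov by (simp add: D_frag_of outs_eq)
    ultimately show False
      using \<open>e \<noteq> b\<close> by (auto simp: lookup_minus split: if_splits)
  qed
  moreover have "Poly_Mapping.keys (ins a) \<noteq> {}"
    using ins_nonzero[OF aq] by simp
  ultimately have "Poly_Mapping.keys (ins a) = {b}" by blast
  then have "ins a = frag_of b"
    by (rule ins_eq_frag_of[OF aq])
  with out(2)[OF a] show ?case by blast
qed

lemma thin_subset_basis: "thin K \<subseteq> (\<Union>q\<in>{0<..}. basis K q)"
  using opetopic by (auto simp: opetopic_directed_complex_def)

text \<open>Reducedness of the complex allows any \<open>a\<close> with
  \<open>ins a = frag_of b\<close>, whereas the network sees only vertices;
  \<open>ex_vertex_ins_eq\<close> bridges the gap. Conversely, a sole edge \<open>b\<close> into a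
  vertex is all of its \<open>ins\<close>, as there are no repeated terms.\<close>

lemma reduced_complex_iff: "reduced_complex K \<longleftrightarrow> (\<forall>q\<le>n. reduced_network (G_minus n K q))"
proof
  assume red: "reduced_complex K"
  show "\<forall>q\<le>n. reduced_network (G_minus n K q)"
    unfolding reduced_network_def
  proof (intro allI impI ballI)
    fix q b
    assume q: "q \<le> n" and "b \<in> thin_edges (G_minus n K q)"
    then have b: "b \<in> thin K" "b \<in> basis K q"
      by (auto simp: thin_edges_G basis_eq_keys_g)
    with red obtain a where a: "a \<in> basis_elements K" "ins a = frag_of b"
      unfolding reduced_complex_def ins_def by blast
    then obtain p where p: "a \<in> basis K p" by (auto simp: basis_elements_def)
    have "p \<noteq> 0"
    proof
      assume "p = 0"
      then have "ins a = 0"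
        using bdry_0[of "frag_of a"] p by (intro poly_mapping_eqI) (simp add: ins_def lookup_bdry_minus)
      with a show False by simp
    qed
    then obtain p' where p': "p = Suc p'" by (cases p) auto
    with p a b keys_ins[of a p'] have "p' = q"
      by (auto intro: basis_disjoint)
    with p p' have aq: "a \<in> basis K (Suc q)" by simp
    then have "Suc q \<le> n" using basis_above[of "Suc q"] by (cases "Suc q \<le> n") auto
    then obtain v where v: "v \<in> Poly_Mapping.keys (x (Suc q))" "ins v = frag_of b"
      using ex_vertex_ins_eq[of a q b] aq a by (auto simp: basis_eq_keys_g)
    have "{e \<in> edges (G_minus n K q) - outputs (G_minus n K q). tgt (G_minus n K q) e = v} = {b}"
      using keys_ins_G[OF q v(1)] v(2) by simp
    then have mem: "e \<in> edges (G_minus n K q) - outputs (G_minus n K q) \<and> tgt (G_minus n K q) e = v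
        \<longleftrightarrow> e = b" for e
      unfolding set_eq_iff mem_Collect_eq singleton_iff by (rule spec)
    from mem[of b] have "b \<notin> outputs (G_minus n K q)" "tgt (G_minus n K q) b = v"
      by auto
    moreover have "d = b" if "d \<in> edges (G_minus n K q) - outputs (G_minus n K q)"
      "tgt (G_minus n K q) d = v" for d
      using mem[of d] that by (rule iffD1[OF _ conjI])
    ultimately show "b \<notin> outputs (G_minus n K q) \<and>
        (\<forall>d\<in>edges (G_minus n K q) - outputs (G_minus n K q).
          tgt (G_minus n K q) d = tgt (G_minus n K q) b \<longrightarrow> d = b)"
      by simp
  qed
next
  assume red: "\<forall>q\<le>n. reduced_network (G_minus n K q)"
  show "reduced_complex K"
    unfolding reduced_complex_def
  proof
    fix b assume b: "b \<in> thin K"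
    then obtain q where bq: "b \<in> basis K q"
      using thin_subset_basis by auto
    then have q: "q \<le> n" using basis_above[of q] by (cases "q \<le> n") auto
    have be: "b \<in> edges (G_minus n K q)"
      using bq q by (simp add: edges_G basis_eq_keys_g)
    have "b \<in> thin_edges (G_minus n K q)"
      using b bq q by (auto simp: thin_edges_G basis_eq_keys_g)
    with red q have b': "b \<notin> outputs (G_minus n K q)" and
      uniq: "\<And>d. d \<in> edges (G_minus n K q) - outputs (G_minus n K q) \<Longrightarrow>
          tgt (G_minus n K q) d = tgt (G_minus n K q) b \<Longrightarrow> d = b"
      unfolding reduced_network_def by blast+
    have "b \<in> (\<Union>a\<in>Poly_Mapping.keys (x (Suc q)). Poly_Mapping.keys (ins a))"
      using be b' nonoutputs_G[OF q] by blast
    then obtain v where v: "v \<in> Poly_Mapping.keys (x (Suc q))" "b \<in> Poly_Mapping.keys (ins v)"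
      by blast
    have "tgt (G_minus n K q) b = v" using tgt_G[OF v] .
    then have "Poly_Mapping.keys (ins v) = {b}"
      using keys_ins_G[OF q v(1)] uniq be b' by blast
    moreover have vq: "v \<in> basis K (Suc q)" using v keys_x by auto
    ultimately have "ins v = frag_of b" by (intro ins_eq_frag_of)
    moreover have "v \<noteq> b" using vq bq basis_disjoint[of v q "Suc q"] by auto
    ultimately show "\<exists>a\<in>basis_elements K. a \<noteq> b \<and> bdry_minus K (frag_of a) = frag_of b"
      using vq by (auto simp: basis_elements_def ins_def)
  qed
qed

end

section \<open>Isomorphisms\<close>

text \<open>Well-formedness of \<open>N\<close> places sources and targets among the vertices, where
  \<open>inv_into\<close> really inverts \<open>\<psi>\<close>.\<close>

lemma network_isomorphism_inverse:
  assumes N: "network N" and iso: "network_isomorphism \<phi> \<psi> N P"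
  shows "network_isomorphism (inv_into (edges N) \<phi>) (inv_into (vertices N) \<psi>) P N"
proof -
  note iso = iso[unfolded network_isomorphism_def]
  let ?f = "inv_into (edges N) \<phi>" and ?g = "inv_into (vertices N) \<psi>"
  have \<phi>: "bij_betw \<phi> (edges N) (edges P)" and \<psi>: "bij_betw \<psi> (vertices N) (vertices P)"
    using iso by auto
  have f: "?f e \<in> edges N" "\<phi> (?f e) = e" if "e \<in> edges P" for e
    using \<phi> that by (auto simp: bij_betw_def intro: inv_into_into f_inv_into_f)
  have g: "?g v \<in> vertices N" "\<psi> (?g v) = v" if "v \<in> vertices P" for v
    using \<psi> that by (auto simp: bij_betw_def intro: inv_into_into f_inv_into_f)
  have gv: "?g (\<psi> v) = v" if "v \<in> vertices N" for v
    using \<psi> that by (auto simp: bij_betw_def)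
  have s: "src N e \<in> vertices N" if "e \<in> edges N" "e \<notin> inputs N" for e
    using N that by (auto simp: network_def)
  have t: "tgt N e \<in> vertices N" if "e \<in> edges N" "e \<notin> outputs N" for e
    using N that by (auto simp: network_def)
  show ?thesis
    unfolding network_isomorphism_def
  proof (intro conjI ballI)
    show "src N (?f e) = ?g (src P e)" if "e \<in> edges P - inputs P" for e
    proof -
      have "?f e \<in> edges N - inputs N" using that iso f[of e] by auto
      then have "src P (\<phi> (?f e)) = \<psi> (src N (?f e))" "?g (\<psi> (src N (?f e))) = src N (?f e)"
        using iso gv s by auto
      with that f[of e] show ?thesis by auto
    qed
    show "tgt N (?f e) = ?g (tgt P e)" if "e \<in> edges P - outputs P" for e
    proof -
      have "?f e \<in> edges N - outputs N" using that iso f[of e] by auto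
      then have "tgt P (\<phi> (?f e)) = \<psi> (tgt N (?f e))" "?g (\<psi> (tgt N (?f e))) = tgt N (?f e)"
        using iso gv t by auto
      with that f[of e] show ?thesis by auto
    qed
  qed (use iso f g \<phi> \<psi> in \<open>auto intro: bij_betw_inv_into\<close>)
qed

text \<open>An isomorphism tests input and output membership on edges only, so the two inclusions
  for \<open>P\<close> have to be supplied.\<close>

lemma network_if_isomorphic:
  assumes N: "network N" and iso: "network_isomorphism \<phi> \<psi> N P"
    and "inputs P \<subseteq> edges P" "outputs P \<subseteq> edges P"
  shows "network P"
proof -
  note iso = iso[unfolded network_isomorphism_def]
  have E: "edges P = \<phi> ` edges N" and V: "vertices P = \<psi> ` vertices N"
    using iso by (auto simp: bij_betw_def)
  have "src P e \<in> vertices P" if "e \<in> edges P - inputs P" for e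
    using that N iso unfolding E V network_def Pi_iff by auto
  moreover have "tgt P e \<in> vertices P" if "e \<in> edges P - outputs P" for e
    using that N iso unfolding E V network_def Pi_iff by auto
  ultimately show ?thesis
    using N assms(3,4) by (auto simp: network_def E V)
qed

lemma network_isomorphism_compose:
  assumes "network N" "network_isomorphism \<phi> \<psi> N P" "network_isomorphism \<phi>' \<psi>' P Q"
  shows "network_isomorphism (\<phi>' \<circ> \<phi>) (\<psi>' \<circ> \<psi>) N Q"
proof -
  note iso = assms(2,3)[unfolded network_isomorphism_def]
  have e: "\<phi> e \<in> edges P" if "e \<in> edges N" for e
    using iso that by (auto simp: bij_betw_def)
  have v: "\<psi> v \<in> vertices P" if "v \<in> vertices N" for v
    using iso that by (auto simp: bij_betw_def)
  show ?thesis
    unfolding network_isomorphism_def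
  proof (intro conjI ballI)
    show "bij_betw (\<phi>' \<circ> \<phi>) (edges N) (edges Q)" "bij_betw (\<psi>' \<circ> \<psi>) (vertices N) (vertices Q)"
      using iso by (auto intro: bij_betw_trans)
  qed (use iso e v in auto)
qed

lemma reduced_network_iff_if_isomorphic:
  assumes N: "network N" and iso: "network_isomorphism \<phi> \<psi> N P"
    and "thin_edges N \<subseteq> edges N" "thin_edges P \<subseteq> edges P"
  shows "reduced_network N \<longleftrightarrow> reduced_network P"
proof -
  note iso = iso[unfolded network_isomorphism_def]
  have E: "edges P = \<phi> ` edges N" and inj: "inj_on \<phi> (edges N)" and inj': "inj_on \<psi> (vertices N)"
    using iso by (auto simp: bij_betw_def)
  have t: "tgt N e \<in> vertices N" if "e \<in> edges N" "e \<notin> outputs N" for e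
    using N that by (auto simp: network_def)
  have thin: "thin_edges P = \<phi> ` thin_edges N"
    using iso E assms(3,4) by auto
  have key: "(\<phi> e \<notin> outputs P \<and> (\<forall>d\<in>edges P - outputs P. tgt P d = tgt P (\<phi> e) \<longrightarrow> d = \<phi> e)) \<longleftrightarrow>
      (e \<notin> outputs N \<and> (\<forall>d\<in>edges N - outputs N. tgt N d = tgt N e \<longrightarrow> d = e))"
    if e: "e \<in> edges N" for e
  proof (cases "e \<in> outputs N")
    case True
    with e iso show ?thesis by auto
  next
    case False
    have NO: "edges P - outputs P = \<phi> ` (edges N - outputs N)"
      using iso E by auto
    have "tgt P (\<phi> d) = tgt P (\<phi> e) \<longleftrightarrow> tgt N d = tgt N e" if "d \<in> edges N - outputs N" for d
      using iso that e False inj_onD[OF inj', of "tgt N d" "tgt N e"] t by auto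
    moreover have "\<phi> d = \<phi> e \<longleftrightarrow> d = e" if "d \<in> edges N - outputs N" for d
      using inj_onD[OF inj, of d e] that e by auto
    moreover have "\<phi> e \<notin> outputs P"
      using iso e False by auto
    ultimately show ?thesis
      using False unfolding NO by auto
  qed
  show ?thesis
    unfolding reduced_network_def thin ball_simps
    using key assms(3) by auto
qed

section \<open>Chain maps induced by bijections of bases\<close>

lemma frag_extend_inverse:
  assumes "\<And>a. a \<in> Poly_Mapping.keys c \<Longrightarrow> g (f a) = a"
  shows "frag_extend (frag_of \<circ> g) (frag_extend (frag_of \<circ> f) c) = c"
proof -
  have "frag_extend (frag_of \<circ> g) (frag_extend (frag_of \<circ> f) c) = frag_extend frag_of c"
    unfolding frag_extend_compose using assms by (intro frag_extend_eq) simp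
  then show ?thesis using frag_expansion[of c] by simp
qed

lemma keys_frag_extend_frag_of:
  "Poly_Mapping.keys (frag_extend (frag_of \<circ> f) c) \<subseteq> f ` Poly_Mapping.keys c"
  using keys_frag_extend[of "frag_of \<circ> f" c] by auto

lemma frag_extend_iso:
  assumes "bij_betw f A B"
  shows "frag_extend (frag_of \<circ> f) \<in> iso (free_Abelian_group A) (free_Abelian_group B)"
proof -
  let ?g = "inv_into A f"
  have f: "f a \<in> B" "?g (f a) = a" if "a \<in> A" for a
    using assms that by (auto simp: bij_betw_def)
  have g: "?g b \<in> A" "f (?g b) = b" if "b \<in> B" for b
    using assms that by (auto simp: bij_betw_def intro: inv_into_into f_inv_into_f)
  have "bij_betw (frag_extend (frag_of \<circ> f)) (carrier (free_Abelian_group A)) (carrier (free_Abelian_group B))"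
  proof (rule bij_betw_byWitness[where f' = "frag_extend (frag_of \<circ> ?g)"])
    show "\<forall>c\<in>carrier (free_Abelian_group A).
        frag_extend (frag_of \<circ> ?g) (frag_extend (frag_of \<circ> f) c) = c"
      using f by (intro ballI frag_extend_inverse) auto
    show "\<forall>c\<in>carrier (free_Abelian_group B).
        frag_extend (frag_of \<circ> f) (frag_extend (frag_of \<circ> ?g) c) = c"
      using g by (intro ballI frag_extend_inverse) auto
    show "frag_extend (frag_of \<circ> f) ` carrier (free_Abelian_group A) \<subseteq> carrier (free_Abelian_group B)"
      using f keys_frag_extend_frag_of[of f] by fastforce
    show "frag_extend (frag_of \<circ> ?g) ` carrier (free_Abelian_group B) \<subseteq> carrier (free_Abelian_group A)"
      using g keys_frag_extend_frag_of[of ?g] by fastforce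
  qed
  moreover from this have "frag_extend (frag_of \<circ> f) \<in> hom (free_Abelian_group A) (free_Abelian_group B)"
    by (intro homI) (blast dest: bij_betwE, simp add: frag_extend_add)
  ultimately show ?thesis
    by (simp add: iso_def)
qed

lemma bij_betw_frag_extend:
  assumes "bij_betw f A B"
  shows "bij_betw (frag_extend (frag_of \<circ> f)) (frag_of ` A) (frag_of ` B)"
  using assms by (auto simp: bij_betw_def inj_on_def image_image frag_of_eq)

lemma frag_extend_chain_of_keys:
  assumes "nonneg_chain c" "\<And>i. Poly_Mapping.lookup c i \<le> 1"
    and "nonneg_chain d" "\<And>i. Poly_Mapping.lookup d i \<le> 1"
    and "inj_on f (Poly_Mapping.keys c)" "f ` Poly_Mapping.keys c = Poly_Mapping.keys d"
  shows "frag_extend (frag_of \<circ> f) c = d"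
proof -
  have "frag_extend (frag_of \<circ> f) c = (\<Sum>a\<in>Poly_Mapping.keys c. frag_of (f a))"
    by (subst chain_eq_sum_keys[OF assms(1,2)]) (simp add: frag_extend_sum)
  also have "\<dots> = (\<Sum>b\<in>Poly_Mapping.keys d. frag_of b)"
    using assms(5) unfolding assms(6)[symmetric] by (simp add: sum.reindex)
  also have "\<dots> = d"
    using chain_eq_sum_keys[OF assms(3,4)] by simp
  finally show ?thesis .
qed

text \<open>The edges are all the basis elements, so the edge maps \<open>\<phi>\<close> extend
  linearly to isomorphisms of chain groups. Compatibility with boundaries is read off from the
  networks on the terms of \<open>x\<close> and propagated by \<open>keys_g_induct\<close>.\<close>

lemma isomorphic_complexes_if_isomorphic_networks:
  assumes "opetopic_directed_complex n K" "opetopic_directed_complex n L"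
    and iso: "\<And>q. q \<le> n \<Longrightarrow> network_isomorphism (\<phi> q) (\<psi> q) (G_minus n K q) (G_minus n L q)"
    and compat: "\<And>q v. q < n \<Longrightarrow> v \<in> vertices (G_minus n K q) \<Longrightarrow> \<phi> (Suc q) v = \<psi> q v"
  shows "isomorphic_complexes K L"
proof -
  interpret K: opetopic_complex n K by unfold_locales fact
  interpret L: opetopic_complex n L by unfold_locales fact
  define F where "F q = frag_extend (frag_of \<circ> \<phi> q)" for q
  have F_diff: "F q (c - d) = F q c - F q d" for q c d
    by (simp add: F_def frag_extend_diff)
  have F_0: "F q 0 = 0" for q
    by (simp add: F_def)
  have basis: "bij_betw (\<phi> q) (basis K q) (basis L q)" for q
  proof (cases "q \<le> n")
    case True
    with iso[of q] show ?thesis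
      by (simp add: network_isomorphism_def K.edges_G L.edges_G K.basis_eq_keys_g L.basis_eq_keys_g)
  qed (simp add: K.basis_above L.basis_above bij_betw_def)
  have \<psi>: "\<psi> q a \<in> Poly_Mapping.keys (L.x (Suc q))"
    if "q \<le> n" "a \<in> Poly_Mapping.keys (K.x (Suc q))" for q a
    using iso[OF that(1)] that(2)
    by (auto simp: network_isomorphism_def K.vertices_G L.vertices_G bij_betw_def)
  have \<phi>_out: "\<phi> q (K.out a) = L.out (\<psi> q a)"
    if q: "q \<le> n" and a: "a \<in> Poly_Mapping.keys (K.x (Suc q))" for q a
  proof -
    have e: "K.out a \<in> edges (G_minus n K q) - inputs (G_minus n K q)"
      using a by (simp add: K.noninputs_G)
    then have "\<phi> q (K.out a) \<in> edges (G_minus n L q) - inputs (G_minus n L q)"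
      using iso[OF q] by (auto simp: network_isomorphism_def bij_betw_def)
    then obtain w where w: "w \<in> Poly_Mapping.keys (L.x (Suc q))" "\<phi> q (K.out a) = L.out w"
      by (auto simp: L.noninputs_G)
    have "w = src (G_minus n L q) (\<phi> q (K.out a))"
      using w L.src_G by simp
    also have "\<dots> = \<psi> q (src (G_minus n K q) (K.out a))"
      using iso[OF q] e by (auto simp: network_isomorphism_def)
    also have "\<dots> = \<psi> q a"
      using a K.src_G by simp
    finally show ?thesis using w by simp
  qed
  \<comment> \<open>The support of \<open>ins a\<close> is the set of edges with target
    \<open>a\<close>, and neither chain has repeated terms, so matching supports is enough.\<close>
  have F_ins: "F q (K.ins a) = L.ins (\<psi> q a)"
    if q: "q \<le> n" and a: "a \<in> Poly_Mapping.keys (K.x (Suc q))" for q a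
    unfolding F_def
  proof (rule frag_extend_chain_of_keys)
    have aq: "a \<in> basis K (Suc q)" using a by (rule K.in_basis_if_in_keys_x)
    have bq: "\<psi> q a \<in> basis L (Suc q)" using \<psi>[OF q a] by (rule L.in_basis_if_in_keys_x)
    show "Poly_Mapping.lookup (K.ins a) i \<le> 1" "Poly_Mapping.lookup (L.ins (\<psi> q a)) j \<le> 1" for i j
      using K.good_lookup_le_1[OF K.good_ins[OF aq]] L.good_lookup_le_1[OF L.good_ins[OF bq]] by auto
    have "inj_on (\<phi> q) (basis K q)" using basis by (auto simp: bij_betw_def)
    then show "inj_on (\<phi> q) (Poly_Mapping.keys (K.ins a))"
      using K.keys_ins[OF aq] by (rule inj_on_subset)
    have inj: "inj_on (\<psi> q) (vertices (G_minus n K q))"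
      and E: "edges (G_minus n L q) = \<phi> q ` edges (G_minus n K q)"
      using iso[OF q] by (auto simp: network_isomorphism_def bij_betw_def)
    have tgt: "tgt (G_minus n L q) (\<phi> q e) = \<psi> q a \<longleftrightarrow> tgt (G_minus n K q) e = a"
      if e: "e \<in> edges (G_minus n K q) - outputs (G_minus n K q)" for e
    proof -
      obtain b where "b \<in> Poly_Mapping.keys (K.x (Suc q))" "e \<in> Poly_Mapping.keys (K.ins b)"
        using e unfolding K.nonoutputs_G[OF q] by auto
      then have "tgt (G_minus n K q) e \<in> vertices (G_minus n K q)"
        using K.tgt_G by (simp add: K.vertices_G)
      moreover have "tgt (G_minus n L q) (\<phi> q e) = \<psi> q (tgt (G_minus n K q) e)"
        using iso[OF q] e by (simp add: network_isomorphism_def)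
      ultimately show ?thesis
        using inj_onD[OF inj, of "tgt (G_minus n K q) e" a] a by (auto simp: K.vertices_G)
    qed
    have "edges (G_minus n L q) - outputs (G_minus n L q) =
        \<phi> q ` (edges (G_minus n K q) - outputs (G_minus n K q))"
      using iso[OF q] E by (auto simp: network_isomorphism_def)
    then show "\<phi> q ` Poly_Mapping.keys (K.ins a) = Poly_Mapping.keys (L.ins (\<psi> q a))"
      unfolding K.keys_ins_G[OF q a] L.keys_ins_G[OF q \<psi>[OF q a]] using tgt by auto
  qed auto
  have F_D_linear: "F q (K.D c) = L.D (F (Suc q) c)"
    if "\<And>a. a \<in> Poly_Mapping.keys c \<Longrightarrow> F q (K.D (frag_of a)) = L.D (frag_of (\<phi> (Suc q) a))" for q c
  proof -
    have "Poly_Mapping.keys c \<subseteq> {a. F q (K.D (frag_of a)) = L.D (frag_of (\<phi> (Suc q) a))}"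
      using that by auto
    then show ?thesis
      by (induction c rule: frag_induction)
        (auto simp: K.D_diff L.D_diff F_diff, auto simp: F_def K.D_def L.D_def)
  qed
  have F_D_basis: "F q (K.D (frag_of a)) = L.D (frag_of (\<phi> (Suc q) a))"
    if "a \<in> basis K (Suc q)" "q < n" for q a
  proof -
    from that have "a \<in> Poly_Mapping.keys (K.g (Suc q))" "Suc q \<le> n"
      by (auto simp: K.basis_eq_keys_g)
    then show ?thesis
    proof (induction rule: K.keys_g_induct)
      case (input a)
      have q: "q \<le> n" using \<open>q < n\<close> by simp
      have "F q (K.D (frag_of a)) = F q (frag_of (K.out a) - K.ins a)"
        using input by (simp add: K.D_frag_of K.outs_eq[OF K.in_basis_if_in_keys_x])
      also have "\<dots> = frag_of (L.out (\<psi> q a)) - L.ins (\<psi> q a)"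
        by (simp add: F_diff F_ins[OF q input]) (simp add: F_def \<phi>_out[OF q input])
      also have "\<dots> = L.D (frag_of (\<psi> q a))"
        using \<psi>[OF q input] by (simp add: L.D_frag_of L.outs_eq[OF L.in_basis_if_in_keys_x])
      \<comment> \<open>The same \<open>a\<close> is an edge in degree \<open>Suc q\<close> and a
        vertex in degree \<open>q\<close>; \<open>compat\<close> identifies its two images.\<close>
      finally show ?case
        using input compat[OF \<open>q < n\<close>] by (simp add: K.vertices_G)
    next
      case (out v)
      have q: "Suc q \<le> n" using \<open>q < n\<close> by simp
      have v: "v \<in> basis K (Suc (Suc q))" using out(1) by (rule K.in_basis_if_in_keys_x)
      have w: "\<psi> (Suc q) v \<in> basis L (Suc (Suc q))"
        using \<psi>[OF q out(1)] by (rule L.in_basis_if_in_keys_x)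
      \<comment> \<open>The element \<open>out v\<close> is not a vertex below, but it is parallel
        to \<open>ins v\<close>, for whose terms the claim is already known.\<close>
      have "F q (K.D (frag_of (K.out v))) = F q (K.D (K.ins v))"
        using K.D_out[OF v] by simp
      also have "\<dots> = L.D (F (Suc q) (K.ins v))"
        using out(2) by (intro F_D_linear)
      also have "\<dots> = L.D (frag_of (\<phi> (Suc q) (K.out v)))"
        using L.D_out[OF w] by (simp add: F_ins[OF q out(1)] \<phi>_out[OF q out(1)])
      finally show ?case .
    qed
  qed
  have F_bdry: "F q (bdry K c) = bdry L (F (Suc q) c)"
    if c: "Poly_Mapping.keys c \<subseteq> basis K (Suc q)" for q c
  proof -
    have "Poly_Mapping.keys (F (Suc q) c) \<subseteq> basis L (Suc q)"
      using keys_frag_extend_frag_of[of "\<phi> (Suc q)" c] c basis[of "Suc q"]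
      by (auto simp: F_def bij_betw_def)
    moreover have "F q (K.D c) = L.D (F (Suc q) c)"
    proof (cases "q < n")
      case True
      with c F_D_basis show ?thesis by (intro F_D_linear) auto
    next
      case False
      with c show ?thesis by (simp add: K.basis_above K.D_def L.D_def F_def)
    qed
    ultimately show ?thesis
      using c K.bdry_eq_D L.bdry_eq_D by simp
  qed
  have thin: "bij_betw (\<phi> q) (basis K q \<inter> thin K) (basis L q \<inter> thin L)" for q
  proof (cases "q \<le> n")
    case True
    have "a \<in> thin K \<longleftrightarrow> \<phi> q a \<in> thin L" if "a \<in> basis K q" for a
      using iso[OF True] basis[of q] that True
      by (auto simp: network_isomorphism_def K.edges_G K.thin_edges_G L.thin_edges_G
          K.basis_eq_keys_g L.basis_eq_keys_g bij_betw_def)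
    moreover have "inj_on (\<phi> q) (basis K q \<inter> thin K)"
      using basis[of q] by (auto simp: bij_betw_def intro: inj_on_subset)
    moreover from calculation(1) have "\<phi> q ` (basis K q \<inter> thin K) = \<phi> q ` basis K q \<inter> thin L"
      by auto
    ultimately show ?thesis
      using basis[of q] by (simp add: bij_betw_def)
  qed (simp add: K.basis_above L.basis_above bij_betw_def)
  show ?thesis
    unfolding isomorphic_complexes_def
  proof (intro exI[of _ F] conjI allI ballI)
    show "F q \<in> iso (chain_group K q) (chain_group L q)" for q
      unfolding F_def chain_group_def by (rule frag_extend_iso[OF basis])
    show "F q (bdry K c) = bdry L (F (Suc q) c)" if "c \<in> carrier (chain_group K (Suc q))" for q c
      using that by (intro F_bdry) (simp add: chain_group_def)
    show "aug L (F 0 c) = aug K c" if "c \<in> carrier (chain_group K 0)" for c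
    proof -
      have c: "Poly_Mapping.keys c \<subseteq> basis K 0"
        using that by (simp add: chain_group_def)
      moreover have "Poly_Mapping.keys (F 0 c) \<subseteq> basis L 0"
        using keys_frag_extend_frag_of[of "\<phi> 0" c] c basis[of 0] by (auto simp: F_def bij_betw_def)
      ultimately show ?thesis
        using coeff_sum_frag_extend_frag_of[of "\<phi> 0" c] K.aug_eq L.aug_eq by (simp add: F_def comp_def)
    qed
    show "bij_betw (F q) (frag_of ` basis K q) (frag_of ` basis L q)"
      "bij_betw (F q) (frag_of ` (basis K q \<inter> thin K)) (frag_of ` (basis L q \<inter> thin L))" for q
      unfolding F_def by (intro bij_betw_frag_extend basis thin)+
  qed
qed

section \<open>Opetopic sequences\<close>

text \<open>Paths through exactly one vertex. Its reflexive transitive closure replaces the list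
  encoding of paths.\<close>

definition edge_step :: "('e, 'v, 'm) network_data_scheme \<Rightarrow> ('e \<times> 'e) set" where
  "edge_step N = {(d, e). d \<in> edges N - outputs N \<and> e \<in> edges N - inputs N \<and> tgt N d = src N e}"

lemma network_path_iff_rtrancl:
  assumes N: "network N"
  shows "(\<exists>es vs. network_path N d es vs e) \<longleftrightarrow> d \<in> edges N \<and> (d, e) \<in> (edge_step N)\<^sup>*"
proof
  assume "\<exists>es vs. network_path N d es vs e"
  then obtain es vs where p: "network_path N d es vs e" by blast
  have "(es ! 0, es ! r) \<in> (edge_step N)\<^sup>*" if "r < length es" for r
    using that
  proof (induction r)
    case (Suc r)
    then have "(es ! r, es ! Suc r) \<in> edge_step N"
      using p by (auto simp: network_path_def edge_step_def)
    with Suc show ?case by (auto intro: rtrancl_into_rtrancl)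
  qed simp
  moreover have "es \<noteq> []" "hd es = d" "last es = e" "set es \<subseteq> edges N"
    using p by (auto simp: network_path_def)
  ultimately show "d \<in> edges N \<and> (d, e) \<in> (edge_step N)\<^sup>*"
    using hd_in_set[of es] by (auto simp: hd_conv_nth last_conv_nth)
next
  assume "d \<in> edges N \<and> (d, e) \<in> (edge_step N)\<^sup>*"
  then have "(d, e) \<in> (edge_step N)\<^sup>*" and d: "d \<in> edges N" by auto
  then show "\<exists>es vs. network_path N d es vs e"
  proof (induction rule: rtrancl_induct)
    case base
    then have "network_path N d [d] [] d" by (simp add: network_path_def)
    then show ?case by blast
  next
    case (step y z)
    then obtain es vs where p: "network_path N d es vs y" by blast
    have z: "y \<in> edges N - outputs N" "z \<in> edges N - inputs N" "tgt N y = src N z"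
      using step by (auto simp: edge_step_def)
    then have "tgt N y \<in> vertices N" using N by (auto simp: network_def)
    have len: "length es = Suc (length vs)" and "last es = y"
      using p by (auto simp: network_path_def)
    moreover from len have "es \<noteq> []" by auto
    ultimately have "es ! length vs = y" by (simp add: last_conv_nth)
    then have "network_path N d (es @ [z]) (vs @ [tgt N y]) z"
      using p z len \<open>es \<noteq> []\<close> \<open>tgt N y \<in> vertices N\<close>
      by (auto simp: network_path_def nth_append less_Suc_eq)
    then show ?case by blast
  qed
qed

lemma acyclic_edge_step:
  assumes "acyclic_network N"
  shows "acyclic (edge_step N)"
proof (rule acyclicI, intro allI notI)
  fix e assume "(e, e) \<in> (edge_step N)\<^sup>+"
  then obtain d where d: "(e, d) \<in> edge_step N" "(d, e) \<in> (edge_step N)\<^sup>*"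
    by (blast dest: tranclD)
  have N: "network N" using assms by (simp add: acyclic_network_def)
  have e: "e \<in> edges N - outputs N" "d \<in> edges N - inputs N" "tgt N e = src N d"
    using d by (auto simp: edge_step_def)
  then have "tgt N e \<in> vertices N" using N by (auto simp: network_def)
  obtain es vs where p: "network_path N d es vs e"
    using network_path_iff_rtrancl[OF N, of d e] d e by auto
  then have "network_path N e (e # es) (tgt N e # vs) e"
    using e \<open>tgt N e \<in> vertices N\<close>
    by (auto simp: network_path_def nth_Cons hd_conv_nth split: nat.splits)
  then have "es = []"
    using assms by (auto simp: acyclic_network_def)
  with p show False by (simp add: network_path_def)
qed

lemma edge_step_subset: "edge_step N \<subseteq> edges N \<times> edges N"
  by (auto simp: edge_step_def)

locale opetopic_sequence_data =
  fixes n :: nat and N :: "nat \<Rightarrow> ('e, 'v) thin_network" and c :: "nat \<Rightarrow> 'v \<Rightarrow> 'e"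
  assumes sequence: "opetopic_sequence n N c"
begin

abbreviation E :: "nat \<Rightarrow> 'e set" where "E q \<equiv> edges (N q)"
abbreviation V :: "nat \<Rightarrow> 'v set" where "V q \<equiv> vertices (N q)"
abbreviation step :: "nat \<Rightarrow> ('e \<times> 'e) set" where "step q \<equiv> edge_step (N q)"

definition leaves :: "nat \<Rightarrow> 'v set \<Rightarrow> 'e \<Rightarrow> bool" where
  "leaves q U d \<longleftrightarrow> d \<notin> inputs (N q) \<and> src (N q) d \<in> U"

definition enters :: "nat \<Rightarrow> 'v set \<Rightarrow> 'e \<Rightarrow> bool" where
  "enters q U d \<longleftrightarrow> d \<notin> outputs (N q) \<and> tgt (N q) d \<in> U"

text \<open>The set \<open>below q e\<close> is the set written \<open>c\<^sup>-\<^sup>1(I\<^sub>e)\<close> in the constellation condition.\<close>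

definition below :: "nat \<Rightarrow> 'e \<Rightarrow> 'v set" where
  "below q e = {v \<in> V q. c q v \<in> inputs_below (N (Suc q)) e}"

lemma opetopic_network: "q \<le> n \<Longrightarrow> opetopic_network (N q)"
  and constellation: "q < n \<Longrightarrow> constellation (c q) (N q) (N (Suc q))"
  and linear: "linear_network (N 0)" and thin_edges_0: "thin_edges (N 0) = {}"
  and edges_top: "\<exists>e. E n = {e}" and vertices_top: "V n = {}"
  using sequence by (auto simp: opetopic_sequence_def)

lemma acyclic_network: "q \<le> n \<Longrightarrow> acyclic_network (N q)"
  and ex1_output: "q \<le> n \<Longrightarrow> \<exists>!e. e \<in> outputs (N q)"
  and thin_edges_subset: "q \<le> n \<Longrightarrow> thin_edges (N q) \<subseteq> inputs (N q)"
  using opetopic_network by (auto simp: opetopic_network_def)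

lemma network: "q \<le> n \<Longrightarrow> network (N q)"
  using acyclic_network by (simp add: acyclic_network_def)

lemma
  assumes "q \<le> n"
  shows finite_edges: "finite (E q)" and finite_vertices: "finite (V q)"
    and inputs_subset: "inputs (N q) \<subseteq> E q" and outputs_subset: "outputs (N q) \<subseteq> E q"
    and src_in_V: "d \<in> E q \<Longrightarrow> d \<notin> inputs (N q) \<Longrightarrow> src (N q) d \<in> V q"
    and tgt_in_V: "d \<in> E q \<Longrightarrow> d \<notin> outputs (N q) \<Longrightarrow> tgt (N q) d \<in> V q"
  using network[OF assms] by (auto simp: network_def)

lemma acyclic_step: "q \<le> n \<Longrightarrow> acyclic (step q)"
  by (simp add: acyclic_edge_step acyclic_network)

text \<open>A finite acyclic relation. Induction along its converse deduces a property of an edge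
  from its successors, that is, from the output edge towards the leaves.\<close>

lemma wf_step_converse:
  assumes "q \<le> n"
  shows "wf ((step q)\<inverse>)"
proof -
  have "finite (step q)"
    using finite_edges[OF assms] by (intro finite_subset[OF edge_step_subset]) simp
  then show ?thesis
    using acyclic_step[OF assms] by (simp add: finite_acyclic_wf_converse)
qed

lemma not_step_cycle: "q \<le> n \<Longrightarrow> (d, e) \<in> step q \<Longrightarrow> (e, d) \<in> (step q)\<^sup>* \<Longrightarrow> False"
  using acyclic_step unfolding acyclic_def by (meson rtrancl_into_trancl2)

lemma bij_c: "q < n \<Longrightarrow> bij_betw (c q) (V q) (inputs (N (Suc q)))"
  and thin_c: "q < n \<Longrightarrow> v \<in> V q \<Longrightarrow> v \<in> thin_vertices (N q) \<longleftrightarrow> c q v \<in> thin_edges (N (Suc q))"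
  using constellation by (auto simp: constellation_def)

lemma ex1_leaving:
  "q < n \<Longrightarrow> e \<in> E (Suc q) \<Longrightarrow> \<exists>!d. d \<in> E q \<and> leaves q (below q e) d \<and> \<not> enters q (below q e) d"
  using constellation[of q] by (auto simp: constellation_def Let_def leaves_def enters_def below_def)

text \<open>The edge supplied by the constellation condition; it will be
  \<open>\<partial>\<^sup>+e\<close>.\<close>

definition outp :: "nat \<Rightarrow> 'e \<Rightarrow> 'e" where
  "outp q e = (THE d. d \<in> E q \<and> leaves q (below q e) d \<and> \<not> enters q (below q e) d)"

lemma
  assumes "q < n" "e \<in> E (Suc q)"
  shows outp_in_E: "outp q e \<in> E q" and leaves_outp: "leaves q (below q e) (outp q e)"
    and not_enters_outp: "\<not> enters q (below q e) (outp q e)"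
  using theI'[OF ex1_leaving[OF assms]] by (auto simp: outp_def)

lemma outp_eqI:
  "q < n \<Longrightarrow> e \<in> E (Suc q) \<Longrightarrow> d \<in> E q \<Longrightarrow> leaves q (below q e) d \<Longrightarrow> \<not> enters q (below q e) d \<Longrightarrow> outp q e = d"
  unfolding outp_def by (rule the1_equality[OF ex1_leaving]) auto

lemma inputs_below_eq:
  "q \<le> n \<Longrightarrow> inputs_below (N q) e = {d \<in> inputs (N q). (d, e) \<in> (step q)\<^sup>*}"
  using network_path_iff_rtrancl[OF network[of q]] inputs_subset[of q] by (auto simp: inputs_below_def)

lemma step_into_input: "(d, e) \<in> (step q)\<^sup>* \<Longrightarrow> e \<in> inputs (N q) \<Longrightarrow> d = e"
  by (induction rule: rtrancl_induct) (auto simp: edge_step_def)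

lemma inputs_below_input:
  "q \<le> n \<Longrightarrow> e \<in> inputs (N q) \<Longrightarrow> inputs_below (N q) e = {e}"
  by (auto simp: inputs_below_eq dest: step_into_input)

lemma c_in_inputs: "q < n \<Longrightarrow> v \<in> V q \<Longrightarrow> c q v \<in> inputs (N (Suc q))"
  using bij_c by (auto simp: bij_betw_def)

lemma c_in_E: "q < n \<Longrightarrow> v \<in> V q \<Longrightarrow> c q v \<in> E (Suc q)"
  using c_in_inputs inputs_subset[of "Suc q"] by auto

lemma below_c: "q < n \<Longrightarrow> v \<in> V q \<Longrightarrow> below q (c q v) = {v}"
  using bij_c[of q] by (auto simp: below_def inputs_below_input c_in_inputs bij_betw_def dest: inj_onD)

lemma below_subset: "below q e \<subseteq> V q"
  by (auto simp: below_def)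

text \<open>Networks as such allow a vertex to have no outgoing edge or several. The constellation
  condition at the input edge \<open>c q v\<close>, whose vertex set is \<open>{v}\<close>, forces
  exactly one.\<close>

definition vout :: "nat \<Rightarrow> 'v \<Rightarrow> 'e" where
  "vout q v = outp q (c q v)"

lemma leaves_enters_asym:
  assumes "q \<le> n" "d \<in> E q" "leaves q {v} d" shows "\<not> enters q {v} d"
proof
  assume "enters q {v} d"
  with assms have "(d, d) \<in> step q"
    by (auto simp: edge_step_def leaves_def enters_def)
  with assms show False by (auto dest: not_step_cycle)
qed

lemma
  assumes "q \<le> n" "v \<in> V q"
  shows vout_in_E: "vout q v \<in> E q" and vout_not_input: "vout q v \<notin> inputs (N q)"
    and src_vout: "src (N q) (vout q v) = v"
    and vout_eqI: "d \<in> E q \<Longrightarrow> d \<notin> inputs (N q) \<Longrightarrow> src (N q) d = v \<Longrightarrow> d = vout q v"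
proof -
  \<comment> \<open>The last network has no vertices, so there is a constellation starting at
    \<open>N q\<close>.\<close>
  have q: "q < n" using assms vertices_top by (cases "q = n") auto
  note c = c_in_E[OF q assms(2)]
  show "vout q v \<in> E q" "vout q v \<notin> inputs (N q)" "src (N q) (vout q v) = v"
    using outp_in_E[OF q c] leaves_outp[OF q c] below_c[OF q assms(2)]
    by (auto simp: vout_def leaves_def)
  show "d = vout q v" if "d \<in> E q" "d \<notin> inputs (N q)" "src (N q) d = v"
  proof -
    have "leaves q {v} d" using that by (simp add: leaves_def)
    then show ?thesis
      using outp_eqI[OF q c that(1)] leaves_enters_asym[OF assms(1) that(1)]
      by (simp add: vout_def below_c[OF q assms(2)])
  qed
qed

lemma step_eq_vout:
  assumes q: "q \<le> n" and "(d, e) \<in> step q"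
  shows "e = vout q (tgt (N q) d)"
proof (rule vout_eqI[OF q])
  show "tgt (N q) d \<in> V q" "e \<in> E q" "e \<notin> inputs (N q)" "src (N q) e = tgt (N q) d"
    using assms tgt_in_V[OF q, of d] by (auto simp: edge_step_def)
qed

text \<open>Going forward there is no choice, so each network is a tree directed towards its output
  edge.\<close>

lemma single_valued_step: "q \<le> n \<Longrightarrow> single_valued (step q)"
  using step_eq_vout[of q] by (auto intro!: single_valuedI)

lemma step_vout:
  "q \<le> n \<Longrightarrow> d \<in> E q \<Longrightarrow> d \<notin> outputs (N q) \<Longrightarrow> (d, vout q (tgt (N q) d)) \<in> step q"
  using tgt_in_V vout_in_E vout_not_input src_vout by (auto simp: edge_step_def)

definition vin :: "nat \<Rightarrow> 'v \<Rightarrow> 'e set" where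
  "vin q v = {d \<in> E q. enters q {v} d}"

text \<open>\<open>vout\<close> is not an input edge, so a path to it from a leaf has a last step,
  taken from an edge that enters \<open>v\<close>.\<close>

lemma below_vout:
  assumes "q < n" "v \<in> V (Suc q)"
  shows "below q (vout (Suc q) v) = (\<Union>d\<in>vin (Suc q) v. below q d)"
proof -
  let ?e = "vout (Suc q) v"
  have q: "Suc q \<le> n" using assms by simp
  note e = vout_in_E[OF q assms(2)] vout_not_input[OF q assms(2)] src_vout[OF q assms(2)]
  have "inputs_below (N (Suc q)) ?e = (\<Union>d\<in>vin (Suc q) v. inputs_below (N (Suc q)) d)"
  proof (intro equalityI subsetI)
    fix i assume i: "i \<in> inputs_below (N (Suc q)) ?e"
    then have "i \<noteq> ?e" "(i, ?e) \<in> (step (Suc q))\<^sup>*"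
      using e by (auto simp: inputs_below_eq[OF q])
    then obtain d where d: "(i, d) \<in> (step (Suc q))\<^sup>*" "(d, ?e) \<in> step (Suc q)"
      by (meson rtranclE)
    then have "d \<in> vin (Suc q) v"
      using e by (auto simp: vin_def edge_step_def enters_def)
    with d i show "i \<in> (\<Union>d\<in>vin (Suc q) v. inputs_below (N (Suc q)) d)"
      by (auto simp: inputs_below_eq[OF q])
  next
    fix i assume "i \<in> (\<Union>d\<in>vin (Suc q) v. inputs_below (N (Suc q)) d)"
    then obtain d where d: "d \<in> vin (Suc q) v" "i \<in> inputs (N (Suc q))" "(i, d) \<in> (step (Suc q))\<^sup>*"
      by (auto simp: inputs_below_eq[OF q])
    then have "(d, ?e) \<in> step (Suc q)"
      using step_vout[OF q, of d] by (auto simp: vin_def enters_def)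
    with d show "i \<in> inputs_below (N (Suc q)) ?e"
      by (auto simp: inputs_below_eq[OF q])
  qed
  then show ?thesis by (auto simp: below_def)
qed

text \<open>Two edges reached from one leaf are comparable, since steps are single-valued. If
  \<open>d\<close> reached \<open>d'\<close>, it would do so through their common successor, which
  \<open>d'\<close> also steps to: a cycle.\<close>

lemma below_disjoint:
  assumes "q < n" "v \<in> V (Suc q)" "d \<in> vin (Suc q) v" "d' \<in> vin (Suc q) v" "d \<noteq> d'"
  shows "below q d \<inter> below q d' = {}"
proof -
  have q: "Suc q \<le> n" using assms by simp
  let ?e = "vout (Suc q) v"
  have step_e: "(d, ?e) \<in> step (Suc q)" if "d \<in> vin (Suc q) v" for d
    using step_vout[OF q, of d] that by (auto simp: vin_def enters_def)
  have no: False
    if d: "d \<in> vin (Suc q) v" "d' \<in> vin (Suc q) v" "d \<noteq> d'" "(d, d') \<in> (step (Suc q))\<^sup>*" for d d'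
  proof -
    obtain d1 where d1: "(d, d1) \<in> step (Suc q)" "(d1, d') \<in> (step (Suc q))\<^sup>*"
      using d by (meson converse_rtranclE)
    then have "d1 = ?e"
      using single_valuedD[OF single_valued_step[OF q]] step_e[OF d(1)] by blast
    with d1 step_e[OF d(2)] show False
      using not_step_cycle[OF q] by blast
  qed
  have "inputs_below (N (Suc q)) d \<inter> inputs_below (N (Suc q)) d' = {}"
    using no[of d d'] no[of d' d] assms
      single_valued_confluent[OF single_valued_step[OF q], of _ d d']
    by (auto simp: inputs_below_eq[OF q])
  then show ?thesis by (auto simp: below_def)
qed

section \<open>The output edge and paths towards it\<close>

definition root :: "nat \<Rightarrow> 'e" where
  "root q = (THE e. e \<in> outputs (N q))"

lemma outputs_eq: "q \<le> n \<Longrightarrow> outputs (N q) = {root q}"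
  using theI'[OF ex1_output[of q]] ex1_output[of q] by (auto simp: root_def)

lemma root_in_E: "q \<le> n \<Longrightarrow> root q \<in> E q"
  using outputs_eq outputs_subset by auto

lemma step_root:
  assumes "q \<le> n" "e \<in> E q"
  shows "(e, root q) \<in> (step q)\<^sup>*"
  using assms(2)
proof (induction e rule: wf_induct_rule[OF wf_step_converse[OF assms(1)]])
  case (1 e)
  show ?case
  proof (cases "e \<in> outputs (N q)")
    case True
    then show ?thesis using outputs_eq[OF assms(1)] by auto
  next
    case False
    from step_vout[OF assms(1) 1(2) False] 1 show ?thesis
      by (auto simp: edge_step_def intro: converse_rtrancl_into_rtrancl)
  qed
qed

lemma below_root: "q < n \<Longrightarrow> below q (root (Suc q)) = V q"
  using step_root[of "Suc q"] c_in_inputs c_in_E by (auto simp: below_def inputs_below_eq)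

text \<open>The vertex set of the root is all of \<open>V q\<close>, and an edge that does not enter
  \<open>V q\<close> has no target.\<close>

lemma outp_root:
  assumes "q < n"
  shows "outp q (root (Suc q)) = root q"
proof -
  have r: "root (Suc q) \<in> E (Suc q)" using assms by (intro root_in_E) simp
  have "outp q (root (Suc q)) \<in> outputs (N q)"
    using not_enters_outp[OF assms r] outp_in_E[OF assms r] tgt_in_V[of q] assms below_root[OF assms]
    by (auto simp: enters_def)
  then show ?thesis using outputs_eq[of q] assms by simp
qed

lemma root_not_input:
  assumes "q < n"
  shows "root q \<notin> inputs (N q)"
  using leaves_outp[OF assms, of "root (Suc q)"] root_in_E[of "Suc q"] outp_root[OF assms] assms
  by (auto simp: leaves_def)

text \<open>Following edges forward while they stay inside the vertex set must end at the only edge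
  that leaves without entering. Loop-freeness rests on this.\<close>

lemma leaves_reaches_outp:
  assumes q: "q < n" and e: "e \<in> E (Suc q)" and d: "d \<in> E q" "leaves q (below q e) d"
  shows "(d, outp q e) \<in> (step q)\<^sup>*"
proof -
  have q': "q \<le> n" using q by simp
  from d show ?thesis
  proof (induction d rule: wf_induct_rule[OF wf_step_converse[OF q']])
    case (1 d)
    show ?case
    proof (cases "enters q (below q e) d")
      case False
      with 1 outp_eqI[OF q e, of d] show ?thesis by simp
    next
      case True
      then have t: "d \<notin> outputs (N q)" "tgt (N q) d \<in> below q e"
        by (auto simp: enters_def)
      then have v: "tgt (N q) d \<in> V q" using below_subset by auto
      have "(d, vout q (tgt (N q) d)) \<in> step q"
        using step_vout[OF q' 1(2) t(1)] .
      moreover have "(vout q (tgt (N q) d), outp q e) \<in> (step q)\<^sup>*"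
        using 1(1)[of "vout q (tgt (N q) d)"] calculation vout_in_E[OF q' v] vout_not_input[OF q' v]
          src_vout[OF q' v] t by (simp add: leaves_def)
      ultimately show ?thesis by (rule converse_rtrancl_into_rtrancl)
    qed
  qed
qed

lemma enters_reaches_outp:
  assumes q: "q < n" and e: "e \<in> E (Suc q)" and d: "d \<in> E q" "enters q (below q e) d"
  shows "(d, outp q e) \<in> (step q)\<^sup>*"
proof -
  have t: "d \<notin> outputs (N q)" "tgt (N q) d \<in> below q e"
    using d by (auto simp: enters_def)
  then have v: "tgt (N q) d \<in> V q" using below_subset by auto
  have q': "q \<le> n" using q by simp
  have "(d, vout q (tgt (N q) d)) \<in> step q"
    using step_vout[OF q' d(1) t(1)] .
  moreover have "(vout q (tgt (N q) d), outp q e) \<in> (step q)\<^sup>*"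
    using vout_not_input[OF q' v] src_vout[OF q' v] t
    by (intro leaves_reaches_outp[OF q e vout_in_E[OF q' v]]) (simp add: leaves_def)
  ultimately show ?thesis by (rule converse_rtrancl_into_rtrancl)
qed

text \<open>Linearity of \<open>N 0\<close>: besides the edge preceding \<open>v\<close> on the
  single path, any other edge with target \<open>v\<close> would close a cycle. It gives
  \<open>\<epsilon>\<partial> = 0\<close>.\<close>

lemma ex1_vin_0:
  assumes "v \<in> V 0"
  shows "\<exists>d. vin 0 v = {d}"
proof -
  obtain e' es vs e where p: "network_path (N 0) e' es vs e" and E0: "E 0 = set es" and V0: "V 0 = set vs"
    using linear by (auto simp: linear_network_def)
  have len: "length es = Suc (length vs)"
    and tgt: "\<And>r. r < length vs \<Longrightarrow> es ! r \<notin> outputs (N 0) \<and> tgt (N 0) (es ! r) = vs ! r"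
    and src: "\<And>r. r < length vs \<Longrightarrow> es ! Suc r \<notin> inputs (N 0) \<and> src (N 0) (es ! Suc r) = vs ! r"
    using p by (auto simp: network_path_def)
  have es: "es ! r \<in> E 0" if "r < length es" for r
    using that E0 by simp
  have path: "(es ! i, es ! j) \<in> (step 0)\<^sup>*" if "i \<le> j" "j < length es" for i j
    using that
  proof (induction rule: dec_induct)
    case (step j)
    then have "(es ! j, es ! Suc j) \<in> step 0"
      using tgt[of j] src[of j] es[of j] es[of "Suc j"] len by (auto simp: edge_step_def)
    with step show ?case by (auto intro: rtrancl_into_rtrancl)
  qed simp
  obtain r where r: "r < length vs" "vs ! r = v"
    using assms V0 by (auto simp: in_set_conv_nth)
  have "d = es ! r" if d: "d \<in> vin 0 v" for d
  proof -
    obtain k where k: "k < length es" "d = es ! k"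
      using d E0 by (auto simp: vin_def in_set_conv_nth)
    have d_out: "d \<notin> outputs (N 0)" "tgt (N 0) d = v"
      using d by (auto simp: vin_def enters_def)
    consider "k = r" | "k < r" | "r < k" by linarith
    then show ?thesis
    proof cases
      case 2
      then have "(es ! r, es ! Suc k) \<in> step 0"
        using tgt[of r] src[of k] tgt[of k] es[of r] es[of "Suc k"] len r k d_out
        by (auto simp: edge_step_def)
      with path[of "Suc k" r] 2 r len show ?thesis
        using not_step_cycle[of 0] by auto
    next
      case 3
      then have "(es ! k, es ! Suc r) \<in> step 0"
        using src[of r] es[of k] es[of "Suc r"] len r k d_out by (auto simp: edge_step_def)
      with path[of "Suc r" k] 3 k show ?thesis
        using not_step_cycle[of 0] by auto
    qed (use k in simp)
  qed
  moreover have "es ! r \<in> vin 0 v"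
    using tgt[of r] r es[of r] len by (auto simp: vin_def enters_def)
  ultimately show ?thesis by blast
qed

end

section \<open>The complex of an opetopic sequence\<close>

text \<open>Bases of different degrees must be disjoint subsets of one type, whereas the networks
  may share edges; \<open>enc\<close> separates the degrees.\<close>

locale encoded_opetopic_sequence = opetopic_sequence_data n N c
  for n :: nat and N :: "nat \<Rightarrow> ('e, 'v) thin_network" and c :: "nat \<Rightarrow> 'v \<Rightarrow> 'e" +
  fixes enc :: "nat \<Rightarrow> 'e \<Rightarrow> 'b"
  assumes enc_inj: "q \<le> n \<Longrightarrow> p \<le> n \<Longrightarrow> d \<in> E q \<Longrightarrow> e \<in> E p \<Longrightarrow> enc q d = enc p e \<Longrightarrow> q = p \<and> d = e"
begin

lemma enc_eq_iff: "q \<le> n \<Longrightarrow> d \<in> E q \<Longrightarrow> e \<in> E q \<Longrightarrow> enc q d = enc q e \<longleftrightarrow> d = e"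
  using enc_inj[of q q d e] by auto

lemma inj_on_enc: "q \<le> n \<Longrightarrow> inj_on (enc q) (E q)"
  by (auto intro!: inj_onI simp: enc_eq_iff)

text \<open>The oriented boundary of a set of vertices: edges internal to \<open>U\<close> cancel.
  The boundary of an edge \<open>e\<close> one degree higher is
  \<open>cut q (below q e)\<close>.\<close>

definition cut :: "nat \<Rightarrow> 'v set \<Rightarrow> ('b \<Rightarrow>\<^sub>0 int)" where
  "cut q U = (\<Sum>d\<in>E q. frag_cmul (of_bool (leaves q U d) - of_bool (enters q U d)) (frag_of (enc q d)))"

lemma lookup_cut:
  assumes "q \<le> n" "d \<in> E q"
  shows "Poly_Mapping.lookup (cut q U) (enc q d) = of_bool (leaves q U d) - of_bool (enters q U d)"
proof -
  have "Poly_Mapping.lookup (cut q U) (enc q d) =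
      (\<Sum>d'\<in>E q. if d' = d then of_bool (leaves q U d') - of_bool (enters q U d') else 0)"
    unfolding cut_def lookup_sum using assms enc_eq_iff by (intro sum.cong) auto
  then show ?thesis
    using assms finite_edges by (simp add: sum.delta)
qed

lemma keys_cut: "Poly_Mapping.keys (cut q U) \<subseteq> enc q ` E q"
  unfolding cut_def using keys_sum[of "\<lambda>d. frag_cmul (of_bool (leaves q U d) - of_bool (enters q U d)) (frag_of (enc q d))" "E q"]
  by force

lemma cut_empty [simp]: "cut q {} = 0"
  by (simp add: cut_def leaves_def enters_def)

lemma cut_Un:
  assumes "U \<inter> W = {}"
  shows "cut q (U \<union> W) = cut q U + cut q W"
proof -
  have "of_bool (leaves q (U \<union> W) d) - of_bool (enters q (U \<union> W) d) =
      (of_bool (leaves q U d) - of_bool (enters q U d)) + (of_bool (leaves q W d) - of_bool (enters q W d) :: int)" for d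
    using assms by (auto simp: leaves_def enters_def)
  then show ?thesis
    by (simp only: cut_def frag_cmul_distrib sum.distrib)
qed

lemma cut_UN:
  assumes "finite I" "\<And>i j. i \<in> I \<Longrightarrow> j \<in> I \<Longrightarrow> i \<noteq> j \<Longrightarrow> U i \<inter> U j = {}"
  shows "cut q (\<Union>i\<in>I. U i) = (\<Sum>i\<in>I. cut q (U i))"
  using assms
proof (induction I)
  case (insert i I)
  then have "U i \<inter> (\<Union>j\<in>I. U j) = {}" by blast
  with insert show ?case by (simp add: cut_Un)
qed simp

lemma cut_singleton:
  assumes q: "q \<le> n" and v: "v \<in> V q"
  shows "cut q {v} = frag_of (enc q (vout q v)) - (\<Sum>d\<in>vin q v. frag_of (enc q d))"
proof -
  have L: "leaves q {v} d \<longleftrightarrow> d = vout q v" if "d \<in> E q" for d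
    using vout_eqI[OF q v that] vout_not_input[OF q v] src_vout[OF q v] by (auto simp: leaves_def)
  have "cut q {v} = (\<Sum>d\<in>E q. (if d = vout q v then frag_of (enc q d) else 0)
      - (if enters q {v} d then frag_of (enc q d) else 0))"
    unfolding cut_def by (intro sum.cong) (auto simp: L frag_cmul_diff_distrib)
  also have "\<dots> = frag_of (enc q (vout q v)) - (\<Sum>d\<in>E q. if enters q {v} d then frag_of (enc q d) else 0)"
    using finite_edges[OF q] vout_in_E[OF q v] by (simp add: sum_subtractf sum.delta)
  also have "(\<Sum>d\<in>E q. if enters q {v} d then frag_of (enc q d) else 0) = (\<Sum>d\<in>vin q v. frag_of (enc q d))"
    using finite_edges[OF q] by (simp add: vin_def sum.inter_filter)
  finally show ?thesis .
qed

text \<open>Recovers degree and edge from an encoded basis element, so that \<open>boundary\<close>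
  can distinguish degrees; arbitrary elsewhere.\<close>

definition label :: "'b \<Rightarrow> nat \<times> 'e" where
  "label = inv_into (SIGMA q:{..n}. E q) (\<lambda>(q, e). enc q e)"

lemma label_enc: "q \<le> n \<Longrightarrow> e \<in> E q \<Longrightarrow> label (enc q e) = (q, e)"
proof -
  assume qe: "q \<le> n" "e \<in> E q"
  have "inj_on (\<lambda>(q, e). enc q e) (SIGMA q:{..n}. E q)"
    using enc_inj by (auto simp: inj_on_def)
  from inv_into_f_f[OF this, of "(q, e)"] qe show ?thesis
    by (simp add: label_def)
qed

definition boundary :: "'b \<Rightarrow> ('b \<Rightarrow>\<^sub>0 int)" where
  "boundary b = (case label b of (q, e) \<Rightarrow> case q of 0 \<Rightarrow> 0 | Suc p \<Rightarrow> cut p (below p e))"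

lemma boundary_enc_0: "e \<in> E 0 \<Longrightarrow> boundary (enc 0 e) = 0"
  by (simp add: boundary_def label_enc)

lemma boundary_enc_Suc: "q < n \<Longrightarrow> e \<in> E (Suc q) \<Longrightarrow> boundary (enc (Suc q) e) = cut q (below q e)"
  by (simp add: boundary_def label_enc)

definition K :: "'b thin_complex" where
  "K = \<lparr>basis = (\<lambda>q. if q \<le> n then enc q ` E q else {}), bdry = frag_extend boundary,
    aug = coeff_sum, thin = (\<Union>q\<le>n. enc q ` thin_edges (N q))\<rparr>"

lemma basis_K: "basis K q = (if q \<le> n then enc q ` E q else {})"
  and bdry_K: "bdry K = frag_extend boundary"
  and aug_K: "aug K = coeff_sum"
  and thin_K: "thin K = (\<Union>q\<le>n. enc q ` thin_edges (N q))"
  by (simp_all add: K_def)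

lemma enc_in_basis_elements: "q \<le> n \<Longrightarrow> e \<in> E q \<Longrightarrow> enc q e \<in> basis_elements K"
  unfolding basis_elements_def basis_K by (intro UN_I[of q]) auto

lemma basis_elements_E:
  assumes "b \<in> basis_elements K"
  obtains q e where "q \<le> n" "e \<in> E q" "b = enc q e"
  using assms unfolding basis_elements_def basis_K by (auto split: if_splits)

text \<open>By additivity one vertex \<open>v\<close> suffices. There the claim is that
  \<open>below\<close> of the outgoing edge is the disjoint union of \<open>below\<close> over the
  incoming edges. This yields \<open>\<partial>\<partial> = 0\<close>.\<close>

lemma boundary_cut:
  assumes q: "q < n" and U: "U \<subseteq> V (Suc q)"
  shows "frag_extend boundary (cut (Suc q) U) = 0"
proof -
  have q': "Suc q \<le> n" using q by simp
  have "frag_extend boundary (cut (Suc q) {v}) = 0" if v: "v \<in> V (Suc q)" for v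
  proof -
    have fin: "finite (vin (Suc q) v)"
      using finite_edges[OF q'] by (simp add: vin_def)
    have "frag_extend boundary (cut (Suc q) {v}) =
        boundary (enc (Suc q) (vout (Suc q) v)) - (\<Sum>d\<in>vin (Suc q) v. boundary (enc (Suc q) d))"
      using fin by (simp add: cut_singleton[OF q' v] frag_extend_diff frag_extend_sum comp_def)
    also have "(\<Sum>d\<in>vin (Suc q) v. boundary (enc (Suc q) d)) = (\<Sum>d\<in>vin (Suc q) v. cut q (below q d))"
      using boundary_enc_Suc[OF q] by (intro sum.cong) (auto simp: vin_def)
    also have "\<dots> = cut q (below q (vout (Suc q) v))"
      using cut_UN[OF fin, of "below q" q] below_disjoint[OF q v] below_vout[OF q v] by simp
    also have "\<dots> = boundary (enc (Suc q) (vout (Suc q) v))"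
      using boundary_enc_Suc[OF q vout_in_E[OF q' v]] by simp
    finally show ?thesis by simp
  qed
  moreover have "finite U"
    using U finite_vertices[OF q'] by (rule finite_subset)
  ultimately show ?thesis
    using cut_UN[of U "\<lambda>v. {v}" "Suc q"] U by (auto simp: frag_extend_sum intro: sum.neutral)
qed

lemma coeff_sum_sum: "finite I \<Longrightarrow> coeff_sum (\<Sum>i\<in>I. f i) = (\<Sum>i\<in>I. coeff_sum (f i))"
  by (induction I rule: finite_induct) (simp_all add: coeff_sum_add)

lemma coeff_sum_cut_0:
  assumes U: "U \<subseteq> V 0"
  shows "coeff_sum (cut 0 U) = 0"
proof -
  have "coeff_sum (cut 0 {v}) = 0" if v: "v \<in> V 0" for v
  proof -
    obtain d where "vin 0 v = {d}" using ex1_vin_0[OF v] by blast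
    then show ?thesis
      by (simp add: cut_singleton[OF _ v] coeff_sum_diff)
  qed
  moreover have "finite U"
    using U finite_vertices[of 0] by (auto intro: finite_subset)
  ultimately show ?thesis
    using cut_UN[of U "\<lambda>v. {v}" 0] U by (auto simp: coeff_sum_sum intro: sum.neutral)
qed

lemma keys_frag_extend_boundary:
  assumes "Poly_Mapping.keys x \<subseteq> basis K (Suc q)"
  shows "Poly_Mapping.keys (frag_extend boundary x) \<subseteq> basis K q"
proof -
  have "Poly_Mapping.keys (boundary b) \<subseteq> basis K q" if b: "b \<in> basis K (Suc q)" for b
  proof -
    obtain e where e: "Suc q \<le> n" "e \<in> E (Suc q)" "b = enc (Suc q) e"
      using b by (auto simp: basis_K split: if_splits)
    then show ?thesis
      using keys_cut[of q "below q e"] boundary_enc_Suc[of q e] by (simp add: basis_K)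
  qed
  then show ?thesis
    using assms keys_frag_extend[of boundary x] by blast
qed

lemma complex_K: "free_augmented_directed_complex K"
  unfolding free_augmented_directed_complex_def
proof (intro conjI allI ballI)
  show "disjoint_family (basis K)"
    using enc_inj by (auto simp: disjoint_family_on_def basis_K)
  show "bdry K \<in> hom (chain_group K (Suc q)) (chain_group K q)" for q
    using keys_frag_extend_boundary[of _ q]
    by (intro homI) (auto simp: chain_group_def bdry_K frag_extend_add)
  show "bdry K (bdry K x) = 0" if "x \<in> carrier (chain_group K (Suc (Suc q)))" for q x
  proof -
    have "Poly_Mapping.keys x \<subseteq> basis K (Suc (Suc q))"
      using that by (simp add: chain_group_def)
    then show ?thesis
    proof (induction x rule: frag_induction)
      case (one b)
      then show ?case
        using boundary_cut[OF _ below_subset] boundary_enc_Suc[of "Suc q"]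
        by (auto simp: bdry_K basis_K split: if_splits)
    qed (simp_all add: bdry_K frag_extend_diff)
  qed
  show "bdry K x = 0" if "x \<in> carrier (chain_group K 0)" for x
    using that boundary_enc_0 unfolding bdry_K
    by (intro frag_extend_eq_0) (auto simp: chain_group_def basis_K)
  show "aug K \<in> hom (chain_group K 0) integer_group"
    by (intro homI) (simp_all add: aug_K coeff_sum_add chain_group_def)
  show "aug K (bdry K x) = 0" if "x \<in> carrier (chain_group K (Suc 0))" for x
  proof -
    have "Poly_Mapping.keys x \<subseteq> basis K (Suc 0)"
      using that by (simp add: chain_group_def)
    then show ?thesis
    proof (induction x rule: frag_induction)
      case (one b)
      then show ?case
        using coeff_sum_cut_0[OF below_subset] boundary_enc_Suc[of 0]
        by (auto simp: bdry_K aug_K basis_K split: if_splits)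
    qed (simp_all add: bdry_K aug_K frag_extend_diff coeff_sum_diff)
  qed
qed

lemma bdry_enc: "q < n \<Longrightarrow> e \<in> E (Suc q) \<Longrightarrow> bdry K (frag_of (enc (Suc q) e)) = cut q (below q e)"
  by (simp add: bdry_K boundary_enc_Suc)

lemma lookup_cut_outside: "b \<notin> enc q ` E q \<Longrightarrow> Poly_Mapping.lookup (cut q U) b = 0"
  using keys_cut[of q U] by (meson in_keys_iff subsetD)

lemma bdry_plus_enc:
  assumes q: "q < n" and e: "e \<in> E (Suc q)"
  shows "bdry_plus K (frag_of (enc (Suc q) e)) = frag_of (enc q (outp q e))"
proof (rule poly_mapping_eqI)
  fix b
  have q': "q \<le> n" using q by simp
  show "Poly_Mapping.lookup (bdry_plus K (frag_of (enc (Suc q) e))) b =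
      Poly_Mapping.lookup (frag_of (enc q (outp q e))) b"
  proof (cases "b \<in> enc q ` E q")
    case False
    then show ?thesis
      using outp_in_E[OF q e] by (auto simp: lookup_bdry_plus bdry_enc[OF q e] lookup_cut_outside)
  next
    case True
    then obtain d where d: "d \<in> E q" "b = enc q d" by blast
    have "d = outp q e \<longleftrightarrow> leaves q (below q e) d \<and> \<not> enters q (below q e) d"
      using leaves_outp[OF q e] not_enters_outp[OF q e] outp_eqI[OF q e d(1)] by metis
    then have "enc q d = enc q (outp q e) \<longleftrightarrow> leaves q (below q e) d \<and> \<not> enters q (below q e) d"
      using enc_eq_iff[OF q' d(1) outp_in_E[OF q e]] by simp
    then show ?thesis
      by (simp add: d(2) lookup_bdry_plus bdry_enc[OF q e] lookup_cut[OF q' d(1)])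
  qed
qed

lemma keys_bdry_minus_enc:
  assumes q: "q < n" and e: "e \<in> E (Suc q)"
  shows "Poly_Mapping.keys (bdry_minus K (frag_of (enc (Suc q) e))) =
    enc q ` {d \<in> E q. enters q (below q e) d \<and> \<not> leaves q (below q e) d}"
proof -
  have q': "q \<le> n" using q by simp
  have *: "enc q d \<in> Poly_Mapping.keys (bdry_minus K (frag_of (enc (Suc q) e))) \<longleftrightarrow>
      enters q (below q e) d \<and> \<not> leaves q (below q e) d" if "d \<in> E q" for d
    unfolding in_keys_iff lookup_bdry_minus bdry_enc[OF q e] lookup_cut[OF q' that] by simp
  have "Poly_Mapping.keys (bdry_minus K (frag_of (enc (Suc q) e))) \<subseteq> enc q ` E q"
    using lookup_cut_outside[of _ q "below q e"]
    unfolding in_keys_iff subset_iff lookup_bdry_minus bdry_enc[OF q e] by fastforce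
  with * show ?thesis by auto
qed

section \<open>Loop-freeness, atomicity and thin elements of the constructed complex\<close>

sublocale K: single_output_complex K
proof
  show "free_augmented_directed_complex K" by (rule complex_K)
  show "\<exists>b. bdry_plus K (frag_of a) = frag_of b" if "a \<in> basis K (Suc q)" for a q
    using that bdry_plus_enc[of q] by (auto simp: basis_K split: if_splits)
qed

lemma out_enc:
  assumes q: "q < n" and e: "e \<in> E (Suc q)"
  shows "K.out (enc (Suc q) e) = enc q (outp q e)"
  using K.outs_eq[of "enc (Suc q) e" q] bdry_plus_enc[OF q e] assms
  by (simp add: K.outs_def basis_K frag_of_eq)

text \<open>The order is reachability within each network, antisymmetric by acyclicity;
  \<open>enters_reaches_outp\<close> puts the terms of \<open>\<partial>\<^sup>-\<close> below that
  of \<open>\<partial>\<^sup>+\<close>.\<close>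

lemma loop_free_K: "loop_free K"
proof (rule K.loop_freeI)
  let ?R = "{(enc q d, enc q e) | q d e. q \<le> n \<and> d \<in> E q \<and> e \<in> E q \<and> (d, e) \<in> (step q)\<^sup>*}"
  have sub: "?R \<subseteq> basis_elements K \<times> basis_elements K"
    using enc_in_basis_elements by blast
  have refl: "(b, b) \<in> ?R" if "b \<in> basis_elements K" for b
    using that by (rule basis_elements_E) blast
  have "trans ?R"
  proof (rule transI)
    fix a b b' assume "(a, b) \<in> ?R" "(b, b') \<in> ?R"
    then obtain q d e p d' e' where "a = enc q d" "b = enc q e" "q \<le> n" "d \<in> E q" "e \<in> E q"
      "(d, e) \<in> (step q)\<^sup>*" "b = enc p d'" "b' = enc p e'" "p \<le> n" "d' \<in> E p" "e' \<in> E p"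
      "(d', e') \<in> (step p)\<^sup>*"
      by blast
    moreover from this have "q = p \<and> e = d'" using enc_inj by metis
    ultimately show "(a, b') \<in> ?R" by (blast intro: rtrancl_trans)
  qed
  moreover have "antisym ?R"
  proof (rule antisymI)
    fix a b assume "(a, b) \<in> ?R" "(b, a) \<in> ?R"
    then obtain q d e p d' e' where *: "a = enc q d" "b = enc q e" "q \<le> n" "d \<in> E q" "e \<in> E q"
      "(d, e) \<in> (step q)\<^sup>*" "b = enc p d'" "a = enc p e'" "p \<le> n" "d' \<in> E p" "e' \<in> E p"
      "(d', e') \<in> (step p)\<^sup>*"
      by blast
    moreover from * have "q = p \<and> e = d'" "q = p \<and> d = e'" using enc_inj by metis+
    ultimately have "(d, e) \<in> (step q)\<^sup>*" "(e, d) \<in> (step q)\<^sup>*" by auto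
    then have "d = e"
      using not_step_cycle[OF *(3)] by (meson converse_rtranclE rtrancl_trans)
    with * show "a = b" by simp
  qed
  ultimately show "partial_order_on (basis_elements K) ?R"
    unfolding partial_order_on_def preorder_on_def refl_on_def
    using refl sub by blast
next
  fix a b q
  let ?R = "{(enc q d, enc q e) | q d e. q \<le> n \<and> d \<in> E q \<and> e \<in> E q \<and> (d, e) \<in> (step q)\<^sup>*}"
  assume "a \<in> basis K (Suc q)" and b: "b \<in> Poly_Mapping.keys (K.ins a)"
  then obtain e where q: "q < n" and e: "e \<in> E (Suc q)" and a: "a = enc (Suc q) e"
    by (auto simp: basis_K split: if_splits)
  obtain d where d: "d \<in> E q" "enters q (below q e) d" "b = enc q d"
    using b keys_bdry_minus_enc[OF q e] by (auto simp: K.ins_def a)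
  have "(d, outp q e) \<in> (step q)\<^sup>*"
    using enters_reaches_outp[OF q e d(1,2)] .
  moreover have "d \<noteq> outp q e"
    using d not_enters_outp[OF q e] by auto
  moreover have "K.out a = enc q (outp q e)"
    using out_enc[OF q e] a by simp
  moreover have "q \<le> n" "outp q e \<in> E q"
    using q outp_in_E[OF q e] by auto
  moreover from this have "enc q d \<noteq> enc q (outp q e)"
    using enc_eq_iff[of q d "outp q e"] d \<open>d \<noteq> outp q e\<close> by simp
  moreover from calculation have "(enc q d, enc q (outp q e)) \<in> ?R"
    using d(1) by blast
  ultimately show "(b, K.out a) \<in> ?R \<and> b \<noteq> K.out a"
    using d(3) by simp
qed

text \<open>The output edge is \<open>\<partial>\<^sup>+\<close> of the next root; any other edge
  \<open>e\<close> is a term of \<open>\<partial>\<^sup>-\<close> of the edge that corresponds to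
  its target.\<close>

lemma atomic_K: "atomic n K"
  unfolding atomic_def
proof (intro conjI allI ballI impI)
  show "basis K q = {}" if "q > n" for q
    using that by (simp add: basis_K)
  obtain t where "E n = {t}" using edges_top by blast
  then show "\<exists>!g. g \<in> basis K n" by (simp add: basis_K)
  fix q b assume q: "q < n" and "b \<in> basis K q"
  then obtain e where e: "e \<in> E q" "b = enc q e" by (auto simp: basis_K)
  have q': "q \<le> n" "Suc q \<le> n" using q by auto
  show "\<exists>p>q. \<exists>a\<in>basis K p. b \<in> Poly_Mapping.keys (bdry_minus K (frag_of a)) \<or>
      b \<in> Poly_Mapping.keys (bdry_plus K (frag_of a))"
  proof (cases "e \<in> outputs (N q)")
    case True
    then have "e = outp q (root (Suc q))"
      using outputs_eq[OF q'(1)] outp_root[OF q] by simp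
    then have "b \<in> Poly_Mapping.keys (bdry_plus K (frag_of (enc (Suc q) (root (Suc q)))))"
      using bdry_plus_enc[OF q root_in_E[OF q'(2)]] e by simp
    moreover have "enc (Suc q) (root (Suc q)) \<in> basis K (Suc q)"
      using q' root_in_E[OF q'(2)] by (simp add: basis_K)
    ultimately show ?thesis by blast
  next
    case False
    let ?v = "tgt (N q) e"
    have v: "?v \<in> V q" using tgt_in_V[OF q'(1) e(1) False] .
    have "enters q {?v} e" using False by (simp add: enters_def)
    moreover from this have "\<not> leaves q {?v} e"
      using leaves_enters_asym[OF q'(1) e(1)] by blast
    ultimately have "b \<in> Poly_Mapping.keys (bdry_minus K (frag_of (enc (Suc q) (c q ?v))))"
      using keys_bdry_minus_enc[OF q c_in_E[OF q v]] below_c[OF q v] e by simp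
    moreover have "enc (Suc q) (c q ?v) \<in> basis K (Suc q)"
      using q' c_in_E[OF q v] by (simp add: basis_K)
    ultimately show ?thesis by blast
  qed
qed

lemma outp_not_thin:
  assumes q: "q < n" and e: "e \<in> E (Suc q)"
  shows "outp q e \<notin> thin_edges (N q)"
  using leaves_outp[OF q e] thin_edges_subset[of q] q by (auto simp: leaves_def)

lemma enc_in_thin_iff:
  assumes "q \<le> n" "e \<in> E q"
  shows "enc q e \<in> thin K \<longleftrightarrow> e \<in> thin_edges (N q)"
proof -
  have "e' \<in> E p" if "p \<le> n" "e' \<in> thin_edges (N p)" for p e'
    using that thin_edges_subset inputs_subset by blast
  with assms enc_inj show ?thesis
    by (auto simp: thin_K) metis
qed

text \<open>A thin edge is an input edge, hence comes from a thin vertex one degree lower, and the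
  sole edge entering that vertex is non-thin.\<close>

lemma bdry_minus_thin:
  assumes "a \<in> thin K"
  shows "\<exists>b\<in>basis_elements K. b \<notin> thin K \<and> bdry_minus K (frag_of a) = frag_of b"
proof -
  obtain p e where p: "p \<le> n" and e: "e \<in> thin_edges (N p)" "a = enc p e"
    using assms by (auto simp: thin_K)
  then obtain q where q: "p = Suc q"
    using thin_edges_0 by (cases p) auto
  then have q': "q < n" "q \<le> n" using p by auto
  have "e \<in> inputs (N (Suc q))"
    using e thin_edges_subset[OF p] q by auto
  then obtain v where v: "v \<in> V q" "e = c q v"
    using bij_c[OF q'(1)] by (auto simp: bij_betw_def)
  then have "v \<in> thin_vertices (N q)"
    using thin_c[OF q'(1)] e q by simp
  then have "\<exists>!d. d \<in> E q - outputs (N q) \<and> tgt (N q) d = v"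
    "\<forall>d\<in>E q - outputs (N q). tgt (N q) d = v \<longrightarrow> d \<notin> thin_edges (N q)"
    using opetopic_network[OF q'(2)] by (auto simp: opetopic_network_def)
  then obtain d where d: "d \<in> E q" "d \<notin> thin_edges (N q)" and vin: "vin q v = {d}"
    unfolding vin_def enters_def by (auto elim!: ex1E)
  have "cut q {v} = frag_of (enc q (vout q v)) - frag_of (enc q d)"
    using cut_singleton[OF q'(2) v(1)] vin by simp
  moreover have "bdry K (frag_of a) = cut q {v}"
    using bdry_enc[OF q'(1) c_in_E[OF q'(1) v(1)]] below_c[OF q'(1) v(1)] e v q by simp
  \<comment> \<open>Otherwise the two terms of the boundary would cancel.\<close>
  moreover have "vout q v \<noteq> d"
  proof
    assume "vout q v = d"
    then have "leaves q {v} d" "enters q {v} d"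
      using vout_not_input[OF q'(2) v(1)] src_vout[OF q'(2) v(1)] vin by (auto simp: leaves_def vin_def)
    then show False using leaves_enters_asym[OF q'(2) d(1)] by blast
  qed
  then have "enc q (vout q v) \<noteq> enc q d"
    using enc_eq_iff[OF q'(2) vout_in_E[OF q'(2) v(1)] d(1)] by simp
  ultimately have "bdry_minus K (frag_of a) = frag_of (enc q d)"
    by (intro poly_mapping_eqI) (auto simp: lookup_bdry_minus lookup_minus)
  moreover have "enc q d \<in> basis_elements K"
    using q' d by (intro enc_in_basis_elements)
  moreover have "enc q d \<notin> thin K"
    using enc_in_thin_iff[OF q'(2) d(1)] d by simp
  ultimately show ?thesis by blast
qed

lemma opetopic_K: "opetopic_directed_complex n K"
  unfolding opetopic_directed_complex_def
proof (intro conjI allI impI ballI)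
  show "free_augmented_directed_complex K" by (rule complex_K)
  show "atomic n K" by (rule atomic_K)
  show "loop_free K" by (rule loop_free_K)
  show "unital K" by (rule K.unitalI) (simp add: aug_K)
  show "thin K \<subseteq> (\<Union>q\<in>{0<..}. basis K q)"
  proof
    fix a assume "a \<in> thin K"
    then obtain q e where q: "q \<le> n" "e \<in> thin_edges (N q)" "a = enc q e"
      by (auto simp: thin_K)
    moreover from q have "q > 0" using thin_edges_0 by (cases "q = 0") auto
    moreover from q have "e \<in> E q" using thin_edges_subset inputs_subset by blast
    ultimately show "a \<in> (\<Union>q\<in>{0<..}. basis K q)" by (auto simp: basis_K)
  qed
  show "\<exists>b\<in>basis_elements K. b \<notin> thin K \<and> bdry_plus K (frag_of a) = frag_of b"
    if q: "0 < q" and a: "a \<in> basis K q" for q a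
  proof -
    obtain p where p: "q = Suc p" using q by (cases q) auto
    then obtain e where q: "p < n" and e: "e \<in> E (Suc p)" "a = enc (Suc p) e"
      using a by (auto simp: basis_K split: if_splits)
    have "enc p (outp p e) \<in> basis_elements K"
      using outp_in_E[OF q e(1)] less_imp_le_nat[OF q] by (intro enc_in_basis_elements)
    moreover have "enc p (outp p e) \<notin> thin K"
      using q enc_in_thin_iff[OF _ outp_in_E[OF q e(1)]] outp_not_thin[OF q e(1)] by simp
    ultimately show ?thesis
      using bdry_plus_enc[OF q e(1)] e by blast
  qed
  show "\<exists>b\<in>basis_elements K. b \<notin> thin K \<and> bdry_minus K (frag_of a) = frag_of b" if "a \<in> thin K" for a
    using that by (rule bdry_minus_thin)
qed

section \<open>The given sequence recovered from the constructed complex\<close>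

sublocale O: opetopic_complex n K
  by unfold_locales (rule opetopic_K)

lemma O_root: "q \<le> n \<Longrightarrow> O.root q = enc q (root q)"
proof (induction rule: inc_induct)
  case base
  have "top_element n K \<in> enc n ` E n"
    using O.root_in_basis[of n] by (simp add: basis_K)
  moreover obtain t where "E n = {t}" using edges_top by blast
  ultimately show ?case
    using root_in_E[of n] by auto
next
  case (step q)
  then show ?case
    using O.root_eq_out[of q] out_enc[of q "root (Suc q)"] root_in_E[of "Suc q"] outp_root[of q] by simp
qed

text \<open>For \<open>q < n\<close> the edges entering but not leaving the full set
  \<open>V q\<close> are those without a source, the root being excluded since it has one. For
  \<open>q = n\<close> the only edge is both input and output.\<close>

lemma keys_O_x:
  assumes "q \<le> n"
  shows "Poly_Mapping.keys (O.x q) = enc q ` inputs (N q)"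
proof (cases "q = n")
  case True
  obtain t where t: "E n = {t}" using edges_top by blast
  have "inputs (N n) = E n"
    using src_in_V[of n] vertices_top inputs_subset[of n] by auto
  then have "inputs (N n) = {root n}"
    using t root_in_E[of n] by auto
  then show ?thesis
    using True O_root[of n] O.x_top by (simp del: O.root_top)
next
  case False
  then have q: "q < n" using assms by simp
  have r: "root (Suc q) \<in> E (Suc q)" using q root_in_E by simp
  have "Poly_Mapping.keys (O.x q) = enc q ` {d \<in> E q. enters q (V q) d \<and> \<not> leaves q (V q) d}"
    using O.x_eq_ins[OF q] O_root[of "Suc q"] keys_bdry_minus_enc[OF q r] below_root[OF q] q
    by (simp add: K.ins_def)
  also have "{d \<in> E q. enters q (V q) d \<and> \<not> leaves q (V q) d} = inputs (N q)"
    using src_in_V[OF assms] tgt_in_V[OF assms] inputs_subset[OF assms] root_not_input[OF q] outputs_eq[OF assms]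
    by (auto simp: enters_def leaves_def)
  finally show ?thesis .
qed

lemma keys_O_x_Suc:
  assumes "q < n"
  shows "Poly_Mapping.keys (O.x (Suc q)) = (\<lambda>v. enc (Suc q) (c q v)) ` V q"
proof -
  have "inputs (N (Suc q)) = c q ` V q"
    using bij_c[OF assms] by (simp add: bij_betw_def)
  then show ?thesis
    using assms keys_O_x[of "Suc q"] by (simp add: image_image)
qed

lemma keys_O_g: "q \<le> n \<Longrightarrow> Poly_Mapping.keys (O.g q) = enc q ` E q"
  using O.basis_eq_keys_g[of q] by (simp add: basis_K)

text \<open>A vertex goes to the basis element of its input edge one degree higher. For
  \<open>q = n\<close> that encoding is meaningless, but there are no vertices.\<close>

lemma network_isomorphism_G:
  assumes q: "q \<le> n"
  shows "network_isomorphism (enc q) (\<lambda>v. enc (Suc q) (c q v)) (N q) (G_minus n K q)"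
  unfolding network_isomorphism_def
proof (intro conjI ballI)
  show "bij_betw (enc q) (E q) (edges (G_minus n K q))"
    using inj_on_enc[OF q] keys_O_g[OF q] by (simp add: bij_betw_def O.edges_G)
  show "e \<in> inputs (N q) \<longleftrightarrow> enc q e \<in> inputs (G_minus n K q)" if "e \<in> E q" for e
    using that keys_O_x[OF q] inj_on_image_mem_iff[OF inj_on_enc[OF q] _ inputs_subset[OF q]]
    by (simp add: O.inputs_G)
  show "e \<in> outputs (N q) \<longleftrightarrow> enc q e \<in> outputs (G_minus n K q)" if "e \<in> E q" for e
    using that q enc_eq_iff root_in_E by (simp add: O.outputs_G O_root outputs_eq)
  show "e \<in> thin_edges (N q) \<longleftrightarrow> enc q e \<in> thin_edges (G_minus n K q)" if "e \<in> E q" for e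
    using that q keys_O_g[OF q] enc_in_thin_iff by (simp add: O.thin_edges_G)
  have V: "v \<in> V q \<Longrightarrow> q < n" for v
    using q vertices_top by (cases "q = n") auto
  show "bij_betw (\<lambda>v. enc (Suc q) (c q v)) (V q) (vertices (G_minus n K q))"
  proof (cases "q = n")
    case True
    then show ?thesis
      by (simp add: vertices_top O.vertices_G O.x_above bij_betw_def)
  next
    case False
    then have q': "q < n" using q by simp
    have "inj_on (c q) (V q)" using bij_c[OF q'] by (simp add: bij_betw_def)
    then have "inj_on (\<lambda>v. enc (Suc q) (c q v)) (V q)"
      using enc_eq_iff[of "Suc q"] q' c_in_E[OF q'] by (auto simp: inj_on_def)
    then show ?thesis
      using keys_O_x_Suc[OF q'] by (simp add: bij_betw_def O.vertices_G)
  qed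
  have v_mem: "enc (Suc q) (c q v) \<in> Poly_Mapping.keys (O.x (Suc q))" if "v \<in> V q" for v
    using keys_O_x_Suc[OF V[OF that]] that by simp
  show "v \<in> thin_vertices (N q) \<longleftrightarrow> enc (Suc q) (c q v) \<in> thin_vertices (G_minus n K q)" if "v \<in> V q" for v
    using v_mem[OF that] V[OF that] thin_c[OF V[OF that] that] enc_in_thin_iff[of "Suc q" "c q v"]
      c_in_E[OF V[OF that] that] by (simp add: O.thin_vertices_G)
  show "src (G_minus n K q) (enc q e) = enc (Suc q) (c q (src (N q) e))" if "e \<in> E q - inputs (N q)" for e
  proof -
    let ?v = "src (N q) e"
    have v: "?v \<in> V q" using that src_in_V[OF q] by auto
    have "e = vout q ?v"
      using that by (intro vout_eqI[OF q v]) auto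
    then have "enc q e = K.out (enc (Suc q) (c q ?v))"
      using out_enc[OF V[OF v] c_in_E[OF V[OF v] v]] by (simp add: vout_def)
    then show ?thesis
      using O.src_G[OF v_mem[OF v]] by simp
  qed
  show "tgt (G_minus n K q) (enc q e) = enc (Suc q) (c q (tgt (N q) e))" if "e \<in> E q - outputs (N q)" for e
  proof -
    let ?v = "tgt (N q) e"
    have v: "?v \<in> V q" using that tgt_in_V[OF q] by auto
    have "enters q {?v} e" using that by (simp add: enters_def)
    moreover from this have "\<not> leaves q {?v} e"
      using leaves_enters_asym[OF q] that by blast
    ultimately have "enc q e \<in> Poly_Mapping.keys (K.ins (enc (Suc q) (c q ?v)))"
      using keys_bdry_minus_enc[OF V[OF v] c_in_E[OF V[OF v] v]] below_c[OF V[OF v] v] that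
      by (simp add: K.ins_def)
    then show ?thesis
      by (rule O.tgt_G[OF v_mem[OF v]])
  qed
qed

lemma isomorphic_sequences_K: "isomorphic_sequences n N c (G_minus n K) G_map"
  unfolding isomorphic_sequences_def
  by (intro exI[of _ enc] exI[of _ "\<lambda>q v. enc (Suc q) (c q v)"]) (simp add: network_isomorphism_G G_map_def)

end

theorem theorem5p3:
  fixes n :: nat
    and N :: "nat \<Rightarrow> ('e, 'v) thin_network"
    and c :: "nat \<Rightarrow> 'v \<Rightarrow> 'e"
  assumes "opetopic_sequence n N c"
  shows "(\<exists>K :: nat thin_complex.
            opetopic_directed_complex n K \<and> isomorphic_sequences n N c (G_minus n K) G_map) \<and>
         (\<forall>(K :: 'b thin_complex) (L :: 'c thin_complex).
            opetopic_directed_complex n K \<and> isomorphic_sequences n N c (G_minus n K) G_map \<and>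
            opetopic_directed_complex n L \<and> isomorphic_sequences n N c (G_minus n L) G_map \<longrightarrow>
            isomorphic_complexes K L) \<and>
         (\<forall>K :: 'b thin_complex.
            opetopic_directed_complex n K \<and> isomorphic_sequences n N c (G_minus n K) G_map \<longrightarrow>
            (reduced_complex K \<longleftrightarrow> opetope n N c))"
proof (intro conjI allI impI)
  interpret opetopic_sequence_data n N c by unfold_locales fact
  show "\<exists>K :: nat thin_complex.
      opetopic_directed_complex n K \<and> isomorphic_sequences n N c (G_minus n K) G_map"
  proof -
    \<comment> \<open>Only finitely many pairs of a degree and an edge occur, so natural numbers can
      name all basis elements.\<close>
    have fin: "finite (SIGMA q:{..n}. E q)"
      using finite_edges by auto
    obtain f :: "nat \<times> 'e \<Rightarrow> nat" where f: "inj_on f (SIGMA q:{..n}. E q)"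
      using finite_imp_inj_to_nat_seg[OF fin] by (elim exE conjE)
    interpret encoded_opetopic_sequence n N c "\<lambda>q e. f (q, e)"
    proof
      show "q = p \<and> d = e"
        if "q \<le> n" "p \<le> n" "d \<in> E q" "e \<in> E p" "f (q, d) = f (p, e)" for q p d e
        using inj_onD[OF f that(5)] that(1-4) by simp
    qed
    show ?thesis
      using opetopic_K isomorphic_sequences_K by blast
  qed
next
  interpret opetopic_sequence_data n N c by unfold_locales fact
  fix K :: "'b thin_complex" and L :: "'c thin_complex"
  assume *: "opetopic_directed_complex n K \<and> isomorphic_sequences n N c (G_minus n K) G_map \<and>
    opetopic_directed_complex n L \<and> isomorphic_sequences n N c (G_minus n L) G_map"
  then obtain \<phi> \<psi> \<phi>' \<psi>' where
    K: "\<And>q. q \<le> n \<Longrightarrow> network_isomorphism (\<phi> q) (\<psi> q) (N q) (G_minus n K q)"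
      "\<And>q v. q < n \<Longrightarrow> v \<in> V q \<Longrightarrow> \<phi> (Suc q) (c q v) = \<psi> q v" and
    L: "\<And>q. q \<le> n \<Longrightarrow> network_isomorphism (\<phi>' q) (\<psi>' q) (N q) (G_minus n L q)"
      "\<And>q v. q < n \<Longrightarrow> v \<in> V q \<Longrightarrow> \<phi>' (Suc q) (c q v) = \<psi>' q v"
    unfolding isomorphic_sequences_def G_map_def by metis
  interpret K: opetopic_complex n K by unfold_locales (use * in blast)
  have G_K: "Defs.network (G_minus n K q)" if "q \<le> n" for q
    by (rule network_if_isomorphic[OF network[OF that] K(1)[OF that]]) (auto simp: G_minus_def Let_def)
  show "isomorphic_complexes K L"
  proof (rule isomorphic_complexes_if_isomorphic_networks)
    \<comment> \<open>The networks of \<open>K\<close> and \<open>L\<close> are compared by passing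
      through \<open>N q\<close>.\<close>
    show "network_isomorphism (\<phi>' q \<circ> inv_into (E q) (\<phi> q)) (\<psi>' q \<circ> inv_into (V q) (\<psi> q))
        (G_minus n K q) (G_minus n L q)" if "q \<le> n" for q
      using network_isomorphism_compose[OF G_K[OF that]
          network_isomorphism_inverse[OF network[OF that] K(1)[OF that]] L(1)[OF that]] .
    show "(\<phi>' (Suc q) \<circ> inv_into (E (Suc q)) (\<phi> (Suc q))) a = (\<psi>' q \<circ> inv_into (V q) (\<psi> q)) a"
      if q: "q < n" and a: "a \<in> vertices (G_minus n K q)" for q a
    proof -
      have \<psi>: "bij_betw (\<psi> q) (V q) (vertices (G_minus n K q))" and
        \<phi>: "bij_betw (\<phi> (Suc q)) (E (Suc q)) (edges (G_minus n K (Suc q)))"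
        using K(1)[of q] K(1)[of "Suc q"] q by (auto simp: network_isomorphism_def)
      obtain v where v: "v \<in> V q" "a = \<psi> q v"
        using \<psi> a by (auto simp: bij_betw_def)
      \<comment> \<open>The maps between networks of \<open>K\<close> are identities, so
        \<open>a\<close> as an edge is the image of \<open>c q v\<close>.\<close>
      then have "inv_into (E (Suc q)) (\<phi> (Suc q)) a = c q v"
        using bij_betw_inv_into_left[OF \<phi> c_in_E[OF q v(1)]] K(2)[OF q v(1)] by simp
      moreover have "inv_into (V q) (\<psi> q) a = v"
        using bij_betw_inv_into_left[OF \<psi> v(1)] v by simp
      ultimately show ?thesis
        using L(2)[OF q v(1)] by simp
    qed
  qed (use * in auto)
next
  interpret opetopic_sequence_data n N c by unfold_locales fact
  fix K :: "'b thin_complex"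
  assume *: "opetopic_directed_complex n K \<and> isomorphic_sequences n N c (G_minus n K) G_map"
  then interpret K: opetopic_complex n K by unfold_locales blast
  obtain \<phi> \<psi> where K: "\<And>q. q \<le> n \<Longrightarrow> network_isomorphism (\<phi> q) (\<psi> q) (N q) (G_minus n K q)"
    using * unfolding isomorphic_sequences_def by blast
  have "reduced_network (N q) \<longleftrightarrow> reduced_network (G_minus n K q)" if "q \<le> n" for q
    using thin_edges_subset[OF that] inputs_subset[OF that]
    by (intro reduced_network_iff_if_isomorphic[OF network[OF that] K[OF that]])
      (auto simp: K.thin_edges_G K.edges_G)
  then show "reduced_complex K \<longleftrightarrow> opetope n N c"
    using assms by (simp add: opetope_def K.reduced_complex_iff)
qed

end
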